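(* Let $f(x)=\frac12\langle x,Ax\rangle+\langle b,x\rangle$ on $\mathbb{R}^n$ with $A$ symmetric positive semi-definite and $b\in\mathrm{Range}(A)$, let $f^\star=\min f$, and let $L>0$ be a Lipschitz constant of $\nabla f$. For $x_0\in\mathbb{R}^n$ let $X^{\rm gr}(t)$, $t\ge0$, be the gradient restarted trajectory started at $x_0$ (see context). Then the function value $f(X^{\rm gr}(t))$ and the trajectory $X^{\rm gr}(t)$ converge to $f^\star$ and to a minimizer $x^\star$ of $f$, respectively, at a globally R-linear rate; that is, there exist constants $c_1>0$, $c_2\in(0,1)$ and $C>0$, independent of $x_0$ and $t$, such that for every $x_0\in\mathbb{R}^n$ there is a minimizer $x^\star$ of $f$ with $$f(X^{\rm gr}(t))-f^\star\le\frac{c_1L\|x_0-x^\star\|^2}{2}e^{-c_2t}\quad\text{and}\quad\|X^{\rm gr}(t)-x^\star\|^2\le C\|x_0-x^\star\|^2e^{-c_2t}\qquad\text{for all }t\ge0.$$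
   Context: $\|\cdot\|$ is the Euclidean norm. For an initial point $r\in\mathbb{R}^n$, let $X(\cdot)=X(\cdot;r)$ denote the solution (continuously differentiable on $[0,\infty)$, twice differentiable on $(0,\infty)$) of $$\ddot X(t)+\frac3t\dot X(t)+\nabla f(X(t))=0\ (t>0),\qquad X(0)=r,\ \dot X(0)=0.$$ The gradient restart time is $$T^{\rm gr}(r;f)=\sup\{t>0:\ \langle\nabla f(X(u;r)),\dot X(u;r)\rangle<0\ \ \forall u\in(0,t)\}.$$ Gradient restarted trajectory: put $E_0=0$, $r_0=x_0$, and recursively $E_{i+1}=T^{\rm gr}(r_i;f)$, $r_{i+1}=X(E_{i+1};r_i)$, $\tau_i=\sum_{j=0}^iE_j$. Then $X^{\rm gr}(0)=x_0$ and $X^{\rm gr}(\tau_i+t)=X(t;r_i)$ for $0<t\le E_{i+1}$, $i=0,1,2,\dots$; equivalently $X^{\rm gr}$ is the continuous solution of $\ddot X(t)+\frac{3}{t-\tau_i}\dot X(t)+\nabla f(X(t))=0$ for $t\in(\tau_i,\tau_{i+1}]$ with $X(\tau_i)=r_i$ and $\dot X(\tau_i)=0$ (right derivative at the restart point). If some $r_i$ is a minimizer of $f$, the trajectory is constant equal to $r_i$ from time $\tau_i$ on. *)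

theory Defs
  imports "HOL-Analysis.Analysis"
begin

abbreviation minimizer :: "('a \<Rightarrow> real) \<Rightarrow> 'a \<Rightarrow> bool" where
  "minimizer f x \<equiv> is_arg_min f (\<lambda>_. True) x"

definition gradient :: "('a::euclidean_space \<Rightarrow> real) \<Rightarrow> 'a \<Rightarrow> 'a" where
  "gradient f x = (THE D. GDERIV f x :> D)"

(* V is the velocity; at t = 0 the filter "at t within {0..}" makes it the right derivative. *)
definition is_ode_solution ::
  "('a::euclidean_space \<Rightarrow> real) \<Rightarrow> 'a \<Rightarrow> (real \<Rightarrow> 'a) \<Rightarrow> bool" where
  "is_ode_solution f r X \<longleftrightarrow>
     (\<exists>V. (\<forall>t\<ge>0. (X has_vector_derivative V t) (at t within {0..})) \<and>
          continuous_on {0..} V \<and>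
          X 0 = r \<and> V 0 = 0 \<and>
          (\<forall>t>0. \<exists>W. (V has_vector_derivative W) (at t) \<and>
                    W + (3 / t) *\<^sub>R V t + gradient f (X t) = 0))"

(* The equation does not constrain X on negative times, hence SOME rather than THE. *)
definition ode_solution :: "('a::euclidean_space \<Rightarrow> real) \<Rightarrow> 'a \<Rightarrow> real \<Rightarrow> 'a" where
  "ode_solution f r = (SOME X. is_ode_solution f r X)"

(* Valued in [0, \<infinity>]: the supremum of the empty set, which arises when r is a
   minimizer, is 0, and \<infinity> means that no restart ever occurs. *)
definition gr_restart_time :: "('a::euclidean_space \<Rightarrow> real) \<Rightarrow> 'a \<Rightarrow> ennreal" where
  "gr_restart_time f r =
     Sup (ennreal ` {t. t > 0 \<and> (\<forall>u\<in>{0<..<t}.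
        gradient f (ode_solution f r u) \<bullet> vector_derivative (ode_solution f r) (at u) < 0)})"

(* If a restart time is infinite, the subsequent points are irrelevant: gr_tau is then
   infinite from there on, and gr_trajectory never refers to them. *)
primrec gr_point :: "('a::euclidean_space \<Rightarrow> real) \<Rightarrow> 'a \<Rightarrow> nat \<Rightarrow> 'a" where
  "gr_point f x0 0 = x0"
| "gr_point f x0 (Suc i) =
     ode_solution f (gr_point f x0 i) (enn2real (gr_restart_time f (gr_point f x0 i)))"

primrec gr_duration :: "('a::euclidean_space \<Rightarrow> real) \<Rightarrow> 'a \<Rightarrow> nat \<Rightarrow> ennreal" where
  "gr_duration f x0 0 = 0"
| "gr_duration f x0 (Suc i) = gr_restart_time f (gr_point f x0 i)"

definition gr_tau :: "('a::euclidean_space \<Rightarrow> real) \<Rightarrow> 'a \<Rightarrow> nat \<Rightarrow> ennreal" where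
  "gr_tau f x0 i = (\<Sum>j\<le>i. gr_duration f x0 j)"

(* Only meaningful for t \<ge> 0. The index in the last branch is unique when it exists,
   as gr_tau is nondecreasing. *)
definition gr_trajectory :: "('a::euclidean_space \<Rightarrow> real) \<Rightarrow> 'a \<Rightarrow> real \<Rightarrow> 'a" where
  "gr_trajectory f x0 t =
     (if t = 0 then x0
      else if \<exists>i. minimizer f (gr_point f x0 i) \<and> gr_tau f x0 i \<le> ennreal t
      then gr_point f x0 (LEAST i. minimizer f (gr_point f x0 i) \<and> gr_tau f x0 i \<le> ennreal t)
      else (let i = (THE i. gr_tau f x0 i < ennreal t \<and> ennreal t \<le> gr_tau f x0 (Suc i))
            in ode_solution f (gr_point f x0 i) (t - enn2real (gr_tau f x0 i))))"

end

theory Submission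
  imports Defs
begin

text \<open>In an eigenbasis of \<open>A\<close>, with \<open>A e = \<omega>\<^sup>2 e\<close>, the trajectory from \<open>r\<close> multiplies the coordinate
  of \<open>r\<close> (relative to a minimizer) along \<open>e\<close> by \<open>\<phi> (\<omega> * t)\<close>, where \<open>\<phi> s = 2 * J\<^sub>1 s / s\<close> for the
  Bessel function \<open>J\<^sub>1\<close>; kernel coordinates never change. Near \<open>0\<close> all the functions \<open>\<phi> (\<omega> * t)\<^sup>2\<close>
  with \<open>\<omega> > 0\<close> decrease, so restart times are bounded below and every restart contracts the
  optimality gap by a fixed factor. The restart time is also bounded above: up to \<open>O(1/s)\<close>,
  \<open>s\<^sup>3 (\<phi>\<^sup>2)'\<close> is a pure oscillation with mean zero, so no nonnegative combination of its rescalings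
  stays negative for long. A uniform contraction over segments of bounded length is a linear
  rate, and off the kernel the gap controls the squared distance to the minimizer.\<close>

section \<open>The Bessel quotient\<close>

text \<open>The bounds on the restart time must be uniform in the starting point, and the upper one
  is the obstacle. Without a restart the gap generically decays only like \<open>t^(-3)\<close>, so
  a linear rate needs restarts that come in time whatever the coordinates of the starting point. The
  frequencies may be incommensurable, so no common period is available, and the weights of the modes
  range over a whole cone. The test function depends on the frequencies only. Its integral against
  the energy derivative is linear in the weights, so positivity for each mode separately, on one
  common interval, covers every nonzero nonnegative combination. Correlation works because all modes
  rescale one function and hence share the phase \<open>\<theta>\<close>; the added 1 makes the test
  function nonnegative and averages out against a mean-zero oscillation. The lower bound on restart
  times serves twice: it yields the contraction factor, and it keeps restarts from accumulating in
  finite time before a minimizer is reached.\<close>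

text \<open>\<open>jinc s = 2 * J\<^sub>1 s / s\<close>, normalised so that \<open>jinc 0 = 1\<close>.\<close>

definition jinc_coeff :: "nat \<Rightarrow> real" where
  "jinc_coeff k = (-1) ^ k / (fact k * fact (Suc k))"

definition jinc :: "real \<Rightarrow> real" where
  "jinc s = (\<Sum>k. jinc_coeff k * (s\<^sup>2 / 4) ^ k)"

definition jinc_deriv :: "real \<Rightarrow> real" where
  "jinc_deriv s = s / 2 * (\<Sum>k. diffs jinc_coeff k * (s\<^sup>2 / 4) ^ k)"

lemma summable_jinc_coeff: "summable (\<lambda>k. jinc_coeff k * y ^ k)"
proof (rule summable_comparison_test')
  show "summable (\<lambda>k. inverse (fact k) * \<bar>y\<bar> ^ k)"
    by (rule summable_exp)
  have "1 \<le> (fact (Suc k) :: real)" for k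
    by (rule fact_ge_1)
  then have "\<bar>jinc_coeff k\<bar> \<le> inverse (fact k)" for k
    unfolding jinc_coeff_def by (simp add: abs_mult divide_simps del: fact_Suc)
  then show "norm (jinc_coeff k * y ^ k) \<le> inverse (fact k) * \<bar>y\<bar> ^ k" if "0 \<le> k" for k
    by (simp add: abs_mult power_abs mult_right_mono)
qed

lemma jinc_coeff_Suc: "real (k + 2) * real (k + 1) * jinc_coeff (Suc k) = - jinc_coeff k"
proof -
  have "real (k + 2) * real (k + 1) * jinc_coeff (Suc k) =
      - ((-1) ^ k * (real (k + 2) * real (k + 1)) /
        ((real (k + 1) * fact k) * (real (k + 2) * fact (Suc k))))"
    unfolding jinc_coeff_def by (simp add: algebra_simps)
  also have "\<dots> = - ((-1) ^ k / (fact k * fact (Suc k)))"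
    by (simp del: fact_Suc)
  finally show ?thesis
    unfolding jinc_coeff_def .
qed

text \<open>With \<open>x = s^2 / 4\<close> and \<open>jinc s = g x\<close>, the equation
  \<open>jinc'' + (3 / s) * jinc' + jinc = 0\<close> becomes
  \<open>x * g'' + 2 * g' + g = 0\<close>. Its coefficient at \<open>x ^ k\<close> vanishes by
  \<open>jinc_coeff_Suc\<close>.\<close>

lemma jinc_series_ode:
  fixes x :: real
  shows "x * (\<Sum>k. diffs (diffs jinc_coeff) k * x ^ k)
    + 2 * (\<Sum>k. diffs jinc_coeff k * x ^ k) + (\<Sum>k. jinc_coeff k * x ^ k) = 0"
proof -
  have s1: "summable (\<lambda>k. diffs jinc_coeff k * y ^ k)" for y :: real
    by (rule termdiff_converges_all) (rule summable_jinc_coeff)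
  have s2: "summable (\<lambda>k. diffs (diffs jinc_coeff) k * y ^ k)" for y :: real
    by (rule termdiff_converges_all) (rule s1)
  have "(\<lambda>k. x * (of_nat k * diffs jinc_coeff k * x ^ (k - Suc 0))) sums
      (x * (\<Sum>k. diffs (diffs jinc_coeff) k * x ^ k))"
    by (intro sums_mult diffs_equiv s2)
  \<comment> \<open>Multiplying by \<open>x\<close> repairs the truncated exponent
    \<open>k - Suc 0\<close>; at \<open>k = 0\<close> the factor \<open>of_nat k\<close> kills the
    term.\<close>
  moreover have "x * (of_nat k * diffs jinc_coeff k * x ^ (k - Suc 0)) =
      of_nat k * diffs jinc_coeff k * x ^ k" for k
    by (cases k) auto
  ultimately have "(\<lambda>k. of_nat k * diffs jinc_coeff k * x ^ k) sums
      (x * (\<Sum>k. diffs (diffs jinc_coeff) k * x ^ k))"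
    by simp
  then have "(\<lambda>k. of_nat k * diffs jinc_coeff k * x ^ k + 2 * (diffs jinc_coeff k * x ^ k)
        + jinc_coeff k * x ^ k) sums
      (x * (\<Sum>k. diffs (diffs jinc_coeff) k * x ^ k)
        + 2 * (\<Sum>k. diffs jinc_coeff k * x ^ k) + (\<Sum>k. jinc_coeff k * x ^ k))"
    by (intro sums_add sums_mult summable_sums s1 summable_jinc_coeff)
  moreover have "of_nat k * diffs jinc_coeff k * x ^ k + 2 * (diffs jinc_coeff k * x ^ k)
        + jinc_coeff k * x ^ k = 0" for k
  proof -
    have "of_nat k * diffs jinc_coeff k * x ^ k + 2 * (diffs jinc_coeff k * x ^ k)
        + jinc_coeff k * x ^ k =
        (real (k + 2) * real (k + 1) * jinc_coeff (Suc k) + jinc_coeff k) * x ^ k"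
      by (simp add: diffs_def algebra_simps)
    then show ?thesis
      by (simp only: jinc_coeff_Suc) simp
  qed
  ultimately have "(\<lambda>k. 0) sums (x * (\<Sum>k. diffs (diffs jinc_coeff) k * x ^ k)
        + 2 * (\<Sum>k. diffs jinc_coeff k * x ^ k) + (\<Sum>k. jinc_coeff k * x ^ k))"
    by simp
  then show ?thesis
    by (rule sums_unique2) (rule sums_zero)
qed

lemma jinc_0 [simp]: "jinc 0 = 1"
  using powser_zero[of jinc_coeff] by (simp add: jinc_def jinc_coeff_def)

lemma jinc_deriv_0 [simp]: "jinc_deriv 0 = 0"
  by (simp add: jinc_deriv_def)

lemma DERIV_jinc: "(jinc has_real_derivative jinc_deriv s) (at s)"
proof -
  have "((\<lambda>x. \<Sum>k. jinc_coeff k * x ^ k) has_real_derivative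
      (\<Sum>k. diffs jinc_coeff k * (s\<^sup>2 / 4) ^ k)) (at (s\<^sup>2 / 4))"
    by (rule termdiffs_strong_converges_everywhere) (rule summable_jinc_coeff)
  moreover have "((\<lambda>s. s\<^sup>2 / 4) has_real_derivative s / 2) (at s)"
    by (auto intro!: derivative_eq_intros)
  ultimately have "((\<lambda>s. \<Sum>k. jinc_coeff k * (s\<^sup>2 / 4) ^ k) has_real_derivative
      (\<Sum>k. diffs jinc_coeff k * (s\<^sup>2 / 4) ^ k) * (s / 2)) (at s)"
    by (rule DERIV_chain2)
  then show ?thesis
    unfolding jinc_deriv_def jinc_def[abs_def] by (simp only: mult.commute)
qed

text \<open>Unlike the differential equation, whose friction term is singular, the series form holds
  at \<open>0\<close> too; this gives continuity of \<open>jinc_deriv\<close> on the whole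
  line.\<close>

lemma jinc_deriv_has_deriv:
  "(jinc_deriv has_real_derivative
    (\<Sum>k. diffs jinc_coeff k * (s\<^sup>2 / 4) ^ k) / 2 +
      s\<^sup>2 / 4 * (\<Sum>k. diffs (diffs jinc_coeff) k * (s\<^sup>2 / 4) ^ k)) (at s)"
proof -
  have "((\<lambda>x. \<Sum>k. diffs jinc_coeff k * x ^ k) has_real_derivative
      (\<Sum>k. diffs (diffs jinc_coeff) k * (s\<^sup>2 / 4) ^ k)) (at (s\<^sup>2 / 4))"
    by (intro termdiffs_strong_converges_everywhere termdiff_converges_all summable_jinc_coeff)
  moreover have "((\<lambda>s. s\<^sup>2 / 4) has_real_derivative s / 2) (at s)"
    by (auto intro!: derivative_eq_intros)
  ultimately have "((\<lambda>s. \<Sum>k. diffs jinc_coeff k * (s\<^sup>2 / 4) ^ k) has_real_derivative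
      (\<Sum>k. diffs (diffs jinc_coeff) k * (s\<^sup>2 / 4) ^ k) * (s / 2)) (at s)"
    by (rule DERIV_chain2)
  moreover have "((\<lambda>s. s / 2) has_real_derivative 1 / 2) (at s)"
    by (auto intro!: derivative_eq_intros)
  ultimately have "((\<lambda>s. s / 2 * (\<Sum>k. diffs jinc_coeff k * (s\<^sup>2 / 4) ^ k)) has_real_derivative
      1 / 2 * (\<Sum>k. diffs jinc_coeff k * (s\<^sup>2 / 4) ^ k) +
      (\<Sum>k. diffs (diffs jinc_coeff) k * (s\<^sup>2 / 4) ^ k) * (s / 2) * (s / 2)) (at s)"
    by (intro DERIV_mult)
  then show ?thesis
    unfolding jinc_deriv_def[abs_def] by (simp add: algebra_simps power2_eq_square)
qed

lemma DERIV_jinc_deriv: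
  assumes "s \<noteq> 0"
  shows "(jinc_deriv has_real_derivative - (3 / s) * jinc_deriv s - jinc s) (at s)"
proof -
  have "- (3 / s) * jinc_deriv s - jinc s =
    (\<Sum>k. diffs jinc_coeff k * (s\<^sup>2 / 4) ^ k) / 2 +
    s\<^sup>2 / 4 * (\<Sum>k. diffs (diffs jinc_coeff) k * (s\<^sup>2 / 4) ^ k)"
    using jinc_series_ode[of "s\<^sup>2 / 4"] assms
    unfolding jinc_deriv_def jinc_def by simp
  then show ?thesis
    using jinc_deriv_has_deriv[of s] by simp
qed

lemma continuous_on_jinc [continuous_intros]:
  "continuous_on S g \<Longrightarrow> continuous_on S (\<lambda>x. jinc (g x))"
  using DERIV_continuous_on[OF has_field_derivative_at_within[OF DERIV_jinc], of UNIV]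
  by (auto intro: continuous_on_compose2)

lemma continuous_on_jinc_deriv [continuous_intros]:
  "continuous_on S g \<Longrightarrow> continuous_on S (\<lambda>x. jinc_deriv (g x))"
proof -
  have "continuous_on UNIV jinc_deriv"
    by (rule DERIV_continuous_on) (rule has_field_derivative_at_within[OF jinc_deriv_has_deriv])
  then show "continuous_on S g \<Longrightarrow> continuous_on S (\<lambda>x. jinc_deriv (g x))"
    by (auto intro: continuous_on_compose2)
qed

text \<open>Since \<open>jinc_deriv\<close> vanishes at \<open>0\<close>, its sign is read off the
  cofactor \<open>h\<close> of \<open>s / 2\<close>, which is continuous with
  \<open>h 0 = - 1 / 2\<close>. Used both for the lower bound on restart times and for a nonzero
  amplitude at infinity.\<close>

lemma jinc_initial_descent:
  obtains d where "d > 0" and "\<And>s. 0 \<le> s \<Longrightarrow> s \<le> d \<Longrightarrow> jinc s > 0"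
    and "\<And>s. 0 < s \<Longrightarrow> s \<le> d \<Longrightarrow> jinc_deriv s < 0"
proof -
  define h where "h s = (\<Sum>k. diffs jinc_coeff k * (s\<^sup>2 / 4) ^ k)" for s :: real
  have "isCont (\<lambda>x. \<Sum>k. diffs jinc_coeff k * x ^ k) y" for y :: real
    by (intro isCont_powser_converges_everywhere termdiff_converges_all summable_jinc_coeff)
  then have "isCont h 0"
    unfolding h_def
    using isCont_o2[of 0 "\<lambda>s. s\<^sup>2 / 4" "\<lambda>x. \<Sum>k. diffs jinc_coeff k * x ^ k"]
    by (simp add: continuous_intros)
  moreover have "h 0 = - 1 / 2"
    using powser_zero[of "diffs jinc_coeff"]
    by (simp add: h_def jinc_coeff_def diffs_def)
  ultimately have "(h \<longlongrightarrow> - 1 / 2) (at 0)"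
    by (simp add: isCont_def)
  then have 1: "eventually (\<lambda>s. h s < 0) (at 0)"
    by (rule order_tendstoD) simp
  have "isCont jinc 0"
    by (rule DERIV_isCont) (rule DERIV_jinc)
  then have "(jinc \<longlongrightarrow> 1) (at 0)"
    by (simp add: isCont_def)
  then have 2: "eventually (\<lambda>s. jinc s > 0) (at 0)"
    by (rule order_tendstoD) simp
  obtain d where d: "d > 0" "\<And>s. s \<noteq> 0 \<Longrightarrow> dist s 0 < d \<Longrightarrow> h s < 0 \<and> jinc s > 0"
    using eventually_conj[OF 1 2] by (auto simp: eventually_at)
  show ?thesis
  proof (rule that[of "d / 2"])
    show "jinc s > 0" if "0 \<le> s" "s \<le> d / 2" for s
      using d(1) d(2)[of s] that by (cases "s = 0") auto
    show "jinc_deriv s < 0" if "0 < s" "s \<le> d / 2" for s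
      using d(1) d(2)[of s] that
      by (auto simp: jinc_deriv_def h_def mult_pos_neg)
  qed (use d in auto)
qed

section \<open>Asymptotic oscillation\<close>

text \<open>Adding or subtracting \<open>K / s\<close> turns the bound into monotonicity:
  \<open>f - K / s\<close> is nondecreasing, and it is bounded because \<open>f + K / s\<close> is
  nonincreasing. The correction tends to 0.\<close>

lemma convergent_at_top_of_deriv_bound:
  fixes f f' :: "real \<Rightarrow> real"
  assumes "s0 > 0"
    and deriv: "\<And>s. s \<ge> s0 \<Longrightarrow> (f has_real_derivative f' s) (at s)"
    and bound: "\<And>s. s \<ge> s0 \<Longrightarrow> \<bar>f' s\<bar> \<le> K / s\<^sup>2"
  obtains l where "(f \<longlongrightarrow> l) at_top"
proof -
  define h where "h s = f s - K / s" for s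
  have "0 \<le> K / s0\<^sup>2"
    using bound[of s0] by simp
  with \<open>s0 > 0\<close> have "K \<ge> 0"
    by (simp add: zero_le_divide_iff)
  have mono: "h x \<le> h y" if "s0 \<le> x" "x \<le> y" for x y
  proof (rule DERIV_nonneg_imp_nondecreasing[OF \<open>x \<le> y\<close>])
    fix s assume "x \<le> s" "s \<le> y"
    then have "s \<ge> s0" "s > 0" using that \<open>s0 > 0\<close> by auto
    then have "(h has_real_derivative f' s + K / s\<^sup>2) (at s)"
      unfolding h_def by (auto intro!: derivative_eq_intros deriv simp: power2_eq_square)
    moreover have "f' s + K / s\<^sup>2 \<ge> 0"
      using bound[OF \<open>s \<ge> s0\<close>] by linarith
    ultimately show "\<exists>y. (h has_real_derivative y) (at s) \<and> y \<ge> 0" by blast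
  qed
  have anti: "f x + K / x \<ge> f y + K / y" if "s0 \<le> x" "x \<le> y" for x y
  proof (rule DERIV_nonpos_imp_nonincreasing[OF \<open>x \<le> y\<close>])
    fix s assume "x \<le> s" "s \<le> y"
    then have "s \<ge> s0" "s > 0" using that \<open>s0 > 0\<close> by auto
    then have "((\<lambda>x. f x + K / x) has_real_derivative f' s - K / s\<^sup>2) (at s)"
      by (auto intro!: derivative_eq_intros deriv simp: power2_eq_square)
    moreover have "f' s - K / s\<^sup>2 \<le> 0"
      using bound[OF \<open>s \<ge> s0\<close>] by linarith
    ultimately show "\<exists>y. ((\<lambda>x. f x + K / x) has_real_derivative y) (at s) \<and> y \<le> 0" by blast
  qed
  have bdd: "bdd_above (h ` {s0..})"
  proof (rule bdd_aboveI2)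
    fix s assume "s \<in> {s0..}"
    then have "s \<ge> s0" "K / s \<ge> 0"
      using \<open>s0 > 0\<close> \<open>K \<ge> 0\<close> by auto
    then show "h s \<le> f s0 + K / s0"
      using anti[of s0 s] by (simp add: h_def)
  qed
  have "(h \<longlongrightarrow> (SUP s\<in>{s0..}. h s)) at_top"
  proof (rule increasing_tendsto)
    show "eventually (\<lambda>s. h s \<le> (SUP s\<in>{s0..}. h s)) at_top"
      using eventually_ge_at_top[of s0] by eventually_elim (auto intro: cSUP_upper bdd)
    fix x assume "x < (SUP s\<in>{s0..}. h s)"
    then obtain s1 where "s1 \<ge> s0" "x < h s1"
      using bdd by (auto simp: less_cSUP_iff)
    then show "eventually (\<lambda>s. x < h s) at_top"
      using eventually_ge_at_top[of s1] mono
      by (metis (mono_tags, lifting) eventually_mono order_less_le_trans)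
  qed
  moreover have "((\<lambda>s. K / s) \<longlongrightarrow> 0) at_top"
    by (intro tendsto_divide_0[OF tendsto_const] filterlim_at_top_imp_at_infinity filterlim_ident)
  ultimately have "((\<lambda>s. h s + K / s) \<longlongrightarrow> (SUP s\<in>{s0..}. h s) + 0) at_top"
    by (rule tendsto_add)
  then show ?thesis
    using that by (simp add: h_def)
qed

section \<open>Long-time averages\<close>

lemma tendsto_integral_mean:
  fixes r :: "real \<Rightarrow> real"
  assumes cont: "continuous_on {s0..} r" and lim: "(r \<longlongrightarrow> l) at_top"
  shows "((\<lambda>T. integral {s0..T} r / T) \<longlongrightarrow> l) at_top"
\<comment> \<open>Continuous Cesaro mean: the quotient of the derivatives is \<open>r x / 1\<close>,
  and only the denominator has to tend to infinity.\<close>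
proof (rule lhospital_at_top_at_top)
  show "LIM x at_top. x :> at_top"
    by (rule filterlim_ident)
  show "\<forall>\<^sub>F x in at_top. ((\<lambda>x. x) has_real_derivative 1) (at x)"
    by (simp add: DERIV_ident)
  show "((\<lambda>x. r x / 1) \<longlongrightarrow> l) at_top"
    using lim by simp
  show "\<forall>\<^sub>F x in at_top. ((\<lambda>T. integral {s0..T} r) has_real_derivative r x) (at x)"
    using eventually_gt_at_top[of s0]
  proof eventually_elim
    fix x assume "x > s0"
    have "continuous_on {s0..x + 1} r"
      by (rule continuous_on_subset[OF cont]) auto
    then have "((\<lambda>T. integral {s0..T} r) has_real_derivative r x) (at x within {s0..x + 1})"
      by (rule integral_has_real_derivative) (use \<open>x > s0\<close> in auto)
    moreover have "at x within {s0..x + 1} = at x"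
      by (rule at_within_Icc_at) (use \<open>x > s0\<close> in auto)
    ultimately show "((\<lambda>T. integral {s0..T} r) has_real_derivative r x) (at x)"
      by simp
  qed
qed simp

text \<open>A nonconstant cosine has a bounded antiderivative, so its integral stays below
  \<open>2 / \<bar>\<alpha>\<bar>\<close> while \<open>T\<close> grows.\<close>

lemma tendsto_integral_mean_cos:
  fixes \<alpha> \<beta> s0 :: real
  assumes "\<alpha> \<noteq> 0"
  shows "((\<lambda>T. integral {s0..T} (\<lambda>t. cos (\<alpha> * t + \<beta>)) / T) \<longlongrightarrow> 0) at_top"
proof (rule Lim_null_comparison)
  show "((\<lambda>T::real. (2 / \<bar>\<alpha>\<bar>) / T) \<longlongrightarrow> 0) at_top"
    by (intro tendsto_divide_0[OF tendsto_const] filterlim_at_top_imp_at_infinity filterlim_ident)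
  show "\<forall>\<^sub>F T in at_top. norm (integral {s0..T} (\<lambda>t. cos (\<alpha> * t + \<beta>)) / T) \<le> (2 / \<bar>\<alpha>\<bar>) / T"
    using eventually_gt_at_top[of "max s0 0"]
  proof eventually_elim
    fix T assume "T > max s0 0"
    then have T: "T > 0" "s0 \<le> T" by auto
    have "((\<lambda>t. cos (\<alpha> * t + \<beta>)) has_integral
        sin (\<alpha> * T + \<beta>) / \<alpha> - sin (\<alpha> * s0 + \<beta>) / \<alpha>) {s0..T}"
    proof (rule fundamental_theorem_of_calculus[OF \<open>s0 \<le> T\<close>])
      fix t assume "t \<in> {s0..T}"
      have "((\<lambda>t. sin (\<alpha> * t + \<beta>) / \<alpha>) has_real_derivative cos (\<alpha> * t + \<beta>)) (at t within {s0..T})"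
        using assms by (auto intro!: derivative_eq_intros)
      then show "((\<lambda>t. sin (\<alpha> * t + \<beta>) / \<alpha>) has_vector_derivative cos (\<alpha> * t + \<beta>))
          (at t within {s0..T})"
        by (simp add: has_real_derivative_iff_has_vector_derivative)
    qed
    then have "integral {s0..T} (\<lambda>t. cos (\<alpha> * t + \<beta>)) =
        (sin (\<alpha> * T + \<beta>) - sin (\<alpha> * s0 + \<beta>)) / \<alpha>"
      by (simp add: integral_unique diff_divide_distrib)
    moreover have "\<bar>sin (\<alpha> * T + \<beta>) - sin (\<alpha> * s0 + \<beta>)\<bar> \<le> 2"
      using abs_sin_le_one[of "\<alpha> * T + \<beta>"] abs_sin_le_one[of "\<alpha> * s0 + \<beta>"] by linarith
    ultimately show "norm (integral {s0..T} (\<lambda>t. cos (\<alpha> * t + \<beta>)) / T) \<le> (2 / \<bar>\<alpha>\<bar>) / T"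
      using T assms by (simp add: divide_right_mono abs_mult)
  qed
qed

text \<open>The substitution \<open>z = s powr (3/2) * jinc s\<close> removes the friction term: it turns the
  equation into \<open>z'' + (1 - 3 / (4 * s\<^sup>2)) * z = 0\<close>, an integrable perturbation of the harmonic
  oscillator.\<close>

lemma jinc_oscillation:
  obtains \<rho> \<theta> where "\<rho> > 0"
    and "((\<lambda>s. 2 * s ^ 3 * jinc s * jinc_deriv s + \<rho>\<^sup>2 * sin (2 * s + 2 * \<theta>)) \<longlongrightarrow> 0) at_top"
proof -
  define z where "z s = s * sqrt s * jinc s" for s
  define v where "v s = 3 / 2 * sqrt s * jinc s + s * sqrt s * jinc_deriv s" for s
  define E where "E s = (z s)\<^sup>2 + (v s)\<^sup>2" for s
  \<comment> \<open>Variation of constants: \<open>(a, b)\<close> is \<open>(z, v)\<close> turned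
    back by the angle \<open>s\<close>, so \<open>z = a * cos s + b * sin s\<close> with
    \<open>v = z'\<close>. The pair would be constant for the pure oscillator; here its derivative
    is \<open>O(1 / s^2)\<close>.\<close>
  define a where "a s = z s * cos s - v s * sin s" for s
  define b where "b s = z s * sin s + v s * cos s" for s
  \<comment> \<open>Writing \<open>s\<close> as a square makes the derivative identities below
    rational in \<open>u\<close>.\<close>
  have root: "\<exists>u>0. s = u\<^sup>2 \<and> sqrt s = u" if "s > 0" for s :: real
    using that by (intro exI[of _ "sqrt s"]) auto
  have dz: "(z has_real_derivative v s) (at s)" if "s > 0" for s
  proof -
    obtain u where u: "u > 0" "s = u\<^sup>2" "sqrt s = u" using root[OF \<open>s > 0\<close>] by blast
    show ?thesis
      unfolding z_def v_def
      by (rule DERIV_cong[OF DERIV_mult[OF DERIV_mult[OF DERIV_ident DERIV_real_sqrt[OF that]]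
              DERIV_jinc]], simp only: u(3), simp only: u(2))
        (use u(1) in \<open>simp add: field_simps power2_eq_square\<close>)
  qed
  have dv: "(v has_real_derivative (3 / (4 * s\<^sup>2) - 1) * z s) (at s)" if "s > 0" for s
  proof -
    obtain u where u: "u > 0" "s = u\<^sup>2" "sqrt s = u" using root[OF \<open>s > 0\<close>] by blast
    have "s \<noteq> 0" using that by simp
    show ?thesis
      unfolding z_def v_def
      by (rule DERIV_cong[OF DERIV_add[OF
            DERIV_mult[OF DERIV_cmult[OF DERIV_real_sqrt[OF that]] DERIV_jinc]
            DERIV_mult[OF DERIV_mult[OF DERIV_ident DERIV_real_sqrt[OF that]]
              DERIV_jinc_deriv[OF \<open>s \<noteq> 0\<close>]]]], simp only: u(3), simp only: u(2))
        (use u(1) in \<open>simp add: field_simps power2_eq_square\<close>)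
  qed
  have dE: "(E has_real_derivative 3 / 2 * z s * v s / s\<^sup>2) (at s)" if "s > 0" for s
    unfolding E_def using that
    by (auto intro!: derivative_eq_intros dz dv simp: field_simps)
  have E_bound: "\<bar>3 / 2 * z s * v s / s\<^sup>2\<bar> \<le> 3 / (4 * s\<^sup>2) * E s" if "s > 0" for s
  proof -
    have "2 * \<bar>z s\<bar> * \<bar>v s\<bar> \<le> E s"
      using sum_squares_bound[of "\<bar>z s\<bar>" "\<bar>v s\<bar>"] by (simp add: E_def)
    then have "3 / (4 * s\<^sup>2) * (2 * \<bar>z s\<bar> * \<bar>v s\<bar>) \<le> 3 / (4 * s\<^sup>2) * E s"
      by (intro mult_left_mono) auto
    then show ?thesis
      by (simp add: abs_mult mult_ac)
  qed
  \<comment> \<open>Gronwall in both directions: \<open>E_bound\<close> compares the derivative of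
    \<open>E\<close> with \<open>3 / (4 * s^2) * E\<close>, and \<open>3 / (4 * s)\<close> is an
    antiderivative of \<open>- 3 / (4 * s^2)\<close>. So \<open>E\<close> stays between positive
    constants once it is positive somewhere.\<close>
  have E_anti: "E y * exp (3 / (4 * y)) \<le> E x * exp (3 / (4 * x))" if "0 < x" "x \<le> y" for x y
  proof (rule DERIV_nonpos_imp_nonincreasing[OF \<open>x \<le> y\<close>])
    fix s assume "x \<le> s" "s \<le> y"
    then have "s > 0" using that by auto
    then have "((\<lambda>s. E s * exp (3 / (4 * s))) has_real_derivative
        (3 / 2 * z s * v s / s\<^sup>2 - 3 / (4 * s\<^sup>2) * E s) * exp (3 / (4 * s))) (at s)"
      by (auto intro!: derivative_eq_intros dE simp: field_simps power2_eq_square)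
    moreover have "(3 / 2 * z s * v s / s\<^sup>2 - 3 / (4 * s\<^sup>2) * E s) * exp (3 / (4 * s)) \<le> 0"
      using E_bound[OF \<open>s > 0\<close>] by (intro mult_nonpos_nonneg) (linarith, simp)
    ultimately show "\<exists>y. ((\<lambda>s. E s * exp (3 / (4 * s))) has_real_derivative y) (at s) \<and> y \<le> 0"
      by blast
  qed
  have E_mono: "E x * exp (- (3 / (4 * x))) \<le> E y * exp (- (3 / (4 * y)))"
    if "0 < x" "x \<le> y" for x y
  proof (rule DERIV_nonneg_imp_nondecreasing[OF \<open>x \<le> y\<close>])
    fix s assume "x \<le> s" "s \<le> y"
    then have "s > 0" using that by auto
    then have "((\<lambda>s. E s * exp (- (3 / (4 * s)))) has_real_derivative
        (3 / 2 * z s * v s / s\<^sup>2 + 3 / (4 * s\<^sup>2) * E s) * exp (- (3 / (4 * s)))) (at s)"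
      by (auto intro!: derivative_eq_intros dE simp: field_simps power2_eq_square)
    moreover have "(3 / 2 * z s * v s / s\<^sup>2 + 3 / (4 * s\<^sup>2) * E s) * exp (- (3 / (4 * s))) \<ge> 0"
      using E_bound[OF \<open>s > 0\<close>] by (intro mult_nonneg_nonneg) (linarith, simp)
    ultimately show "\<exists>y. ((\<lambda>s. E s * exp (- (3 / (4 * s)))) has_real_derivative y) (at s) \<and> y \<ge> 0"
      by blast
  qed
  \<comment> \<open>The limiting amplitude must not be zero. A point where \<open>jinc\<close> is
    positive has \<open>E d > 0\<close>, and \<open>E_mono\<close> carries this to infinity.\<close>
  obtain d where "d > 0" and d: "\<And>s. 0 \<le> s \<Longrightarrow> s \<le> d \<Longrightarrow> jinc s > 0"
    using jinc_initial_descent by metis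
  have "E d > 0"
    using \<open>d > 0\<close> d[of d] by (auto simp: E_def z_def intro!: add_pos_nonneg)
  define K where "K = E d * exp (3 / (4 * d))"
  have E_nonneg: "E s \<ge> 0" for s
    by (simp add: E_def)
  have E_le: "E s \<le> K" if "s \<ge> d" for s
  proof -
    have "E s * 1 \<le> E s * exp (3 / (4 * s))"
      using \<open>d > 0\<close> that by (intro mult_left_mono E_nonneg) simp
    then show ?thesis
      using E_anti[of d s] that \<open>d > 0\<close> by (simp add: K_def)
  qed
  have E_ge: "E s \<ge> E d * exp (- (3 / (4 * d)))" if "s \<ge> d" for s
  proof -
    have "E s * exp (- (3 / (4 * s))) \<le> E s * 1"
      using \<open>d > 0\<close> that by (intro mult_left_mono E_nonneg) simp
    then show ?thesis
      using E_mono[of d s] that \<open>d > 0\<close> by simp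
  qed
  have z2_le: "(z s)\<^sup>2 \<le> K" if "s \<ge> d" for s
  proof -
    have "(z s)\<^sup>2 \<le> E s" by (simp add: E_def)
    then show ?thesis using E_le[OF that] by linarith
  qed
  have z_le: "\<bar>z s\<bar> \<le> 1 + K" if "s \<ge> d" for s
  proof -
    have "0 \<le> (\<bar>z s\<bar> - 1)\<^sup>2" by simp
    then have "2 * \<bar>z s\<bar> \<le> 1 + (z s)\<^sup>2"
      by (simp add: power2_diff)
    then show ?thesis
      using z2_le[OF that] by linarith
  qed
  have da: "(a has_real_derivative - (3 / (4 * s\<^sup>2)) * z s * sin s) (at s)" if "s > 0" for s
    unfolding a_def using that
    by (auto intro!: derivative_eq_intros dz dv simp: field_simps)
  have db: "(b has_real_derivative 3 / (4 * s\<^sup>2) * z s * cos s) (at s)" if "s > 0" for s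
    unfolding b_def using that
    by (auto intro!: derivative_eq_intros dz dv simp: field_simps)
  have small: "\<bar>3 / (4 * s\<^sup>2) * z s * c\<bar> \<le> (3 / 4 * (1 + K)) / s\<^sup>2"
    if "s \<ge> d" "\<bar>c\<bar> \<le> 1" for s c
  proof -
    have "\<bar>z s\<bar> * \<bar>c\<bar> \<le> (1 + K) * 1"
      using z_le[OF \<open>s \<ge> d\<close>] that by (intro mult_mono) auto
    then have "3 / (4 * s\<^sup>2) * (\<bar>z s\<bar> * \<bar>c\<bar>) \<le> 3 / (4 * s\<^sup>2) * (1 + K)"
      by (intro mult_left_mono) auto
    then show ?thesis
      by (simp add: abs_mult mult_ac)
  qed
  obtain \<alpha> where \<alpha>: "(a \<longlongrightarrow> \<alpha>) at_top"
  proof (rule convergent_at_top_of_deriv_bound[OF \<open>d > 0\<close>])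
    show "(a has_real_derivative - (3 / (4 * s\<^sup>2)) * z s * sin s) (at s)" if "s \<ge> d" for s
      using da that \<open>d > 0\<close> by auto
    show "\<bar>- (3 / (4 * s\<^sup>2)) * z s * sin s\<bar> \<le> (3 / 4 * (1 + K)) / s\<^sup>2" if "s \<ge> d" for s
      using small[OF that, of "sin s"] by simp
  qed
  obtain \<beta> where \<beta>: "(b \<longlongrightarrow> \<beta>) at_top"
  proof (rule convergent_at_top_of_deriv_bound[OF \<open>d > 0\<close>])
    show "(b has_real_derivative 3 / (4 * s\<^sup>2) * z s * cos s) (at s)" if "s \<ge> d" for s
      using db that \<open>d > 0\<close> by auto
    show "\<bar>3 / (4 * s\<^sup>2) * z s * cos s\<bar> \<le> (3 / 4 * (1 + K)) / s\<^sup>2" if "s \<ge> d" for s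
      using small[OF that, of "cos s"] by simp
  qed
  have ab: "(a s)\<^sup>2 + (b s)\<^sup>2 = E s" for s
  proof -
    have "(a s)\<^sup>2 + (b s)\<^sup>2 = ((z s)\<^sup>2 + (v s)\<^sup>2) * ((sin s)\<^sup>2 + (cos s)\<^sup>2)"
      unfolding a_def b_def by algebra
    then show ?thesis by (simp add: E_def)
  qed
  have "((\<lambda>s. (a s)\<^sup>2 + (b s)\<^sup>2) \<longlongrightarrow> \<alpha>\<^sup>2 + \<beta>\<^sup>2) at_top"
    by (intro tendsto_intros \<alpha> \<beta>)
  then have "\<alpha>\<^sup>2 + \<beta>\<^sup>2 \<ge> E d * exp (- (3 / (4 * d)))"
    by (rule tendsto_lowerbound)
      (auto simp: ab intro: eventually_mono[OF eventually_ge_at_top[of d]] E_ge)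
  then have pos: "\<alpha>\<^sup>2 + \<beta>\<^sup>2 > 0"
    using \<open>E d > 0\<close> by (smt (verit) exp_gt_zero mult_pos_pos)
  define \<rho> where "\<rho> = sqrt (\<alpha>\<^sup>2 + \<beta>\<^sup>2)"
  have "\<rho> > 0" and \<rho>2: "\<rho>\<^sup>2 = \<alpha>\<^sup>2 + \<beta>\<^sup>2"
    using pos by (auto simp: \<rho>_def)
  \<comment> \<open>Polar form of the limit of \<open>(a, b)\<close>; the minus sign is chosen so
    that \<open>z s\<close> behaves like \<open>\<rho> * cos (s + \<theta>)\<close>.\<close>
  have "(\<alpha> / \<rho>)\<^sup>2 + (- \<beta> / \<rho>)\<^sup>2 = 1"
    using pos \<rho>2 by (auto simp: power_divide simp flip: add_divide_distrib)
  then obtain \<theta> where "\<alpha> / \<rho> = cos \<theta>" "- \<beta> / \<rho> = sin \<theta>"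
    using sincos_total_2pi by metis
  then have \<theta>: "\<alpha> = \<rho> * cos \<theta>" "\<beta> = - (\<rho> * sin \<theta>)"
    using \<open>\<rho> > 0\<close> by (auto simp: field_simps)
  \<comment> \<open>The leading part is \<open>2 * z * v\<close>, asymptotically
    \<open>- \<rho>^2 * sin (2 * s + 2 * \<theta>)\<close>. The remainder \<open>3 * z^2 / s\<close>
    appears because \<open>v\<close> also differentiates the factor
    \<open>s powr (3/2)\<close>.\<close>
  have *: "2 * s ^ 3 * jinc s * jinc_deriv s + \<rho>\<^sup>2 * sin (2 * s + 2 * \<theta>) =
      ((b s)\<^sup>2 - (a s)\<^sup>2 + (\<alpha>\<^sup>2 - \<beta>\<^sup>2)) * sin (2 * s) + (2 * a s * b s - 2 * \<alpha> * \<beta>) * cos (2 * s)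
        - 3 * (z s)\<^sup>2 / s" if "s > 0" for s
  proof -
    have "2 * s ^ 3 * jinc s * jinc_deriv s = 2 * z s * v s - 3 * (z s)\<^sup>2 / s"
    proof -
      obtain u where u: "u > 0" "s = u\<^sup>2" "sqrt s = u"
        using root[OF \<open>s > 0\<close>] by blast
      show ?thesis
        unfolding z_def v_def u(3) unfolding u(2) using u(1)
        by (simp add: field_simps power2_eq_square power3_eq_cube)
    qed
    moreover have "2 * z s * v s = ((b s)\<^sup>2 - (a s)\<^sup>2) * sin (2 * s) + 2 * a s * b s * cos (2 * s)"
    proof -
      have "(sin s)\<^sup>2 + (cos s)\<^sup>2 = 1" by simp
      then show ?thesis
        unfolding a_def b_def sin_double cos_double by algebra
    qed
    moreover have "\<rho>\<^sup>2 * sin (2 * s + 2 * \<theta>) =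
        (\<alpha>\<^sup>2 - \<beta>\<^sup>2) * sin (2 * s) - 2 * \<alpha> * \<beta> * cos (2 * s)"
      unfolding sin_add \<theta> sin_double[of \<theta>] cos_double[of \<theta>]
      by (simp add: algebra_simps power2_eq_square)
    ultimately show ?thesis
      by (simp add: algebra_simps)
  qed
  have "((\<lambda>s. 2 * s ^ 3 * jinc s * jinc_deriv s + \<rho>\<^sup>2 * sin (2 * s + 2 * \<theta>)) \<longlongrightarrow> 0) at_top"
  proof (rule Lim_null_comparison)
    have "((\<lambda>s. \<bar>(b s)\<^sup>2 - (a s)\<^sup>2 + (\<alpha>\<^sup>2 - \<beta>\<^sup>2)\<bar> + \<bar>2 * a s * b s - 2 * \<alpha> * \<beta>\<bar> + 3 * K / s) \<longlongrightarrow>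
        \<bar>\<beta>\<^sup>2 - \<alpha>\<^sup>2 + (\<alpha>\<^sup>2 - \<beta>\<^sup>2)\<bar> + \<bar>2 * \<alpha> * \<beta> - 2 * \<alpha> * \<beta>\<bar> + 0) at_top"
      by (intro tendsto_intros \<alpha> \<beta> tendsto_divide_0[OF tendsto_const]
          filterlim_at_top_imp_at_infinity filterlim_ident)
    then show "((\<lambda>s. \<bar>(b s)\<^sup>2 - (a s)\<^sup>2 + (\<alpha>\<^sup>2 - \<beta>\<^sup>2)\<bar> + \<bar>2 * a s * b s - 2 * \<alpha> * \<beta>\<bar> + 3 * K / s) \<longlongrightarrow>
        0) at_top"
      by simp
    show "\<forall>\<^sub>F s in at_top.
        norm (2 * s ^ 3 * jinc s * jinc_deriv s + \<rho>\<^sup>2 * sin (2 * s + 2 * \<theta>)) \<le>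
        \<bar>(b s)\<^sup>2 - (a s)\<^sup>2 + (\<alpha>\<^sup>2 - \<beta>\<^sup>2)\<bar> + \<bar>2 * a s * b s - 2 * \<alpha> * \<beta>\<bar> + 3 * K / s"
      using eventually_ge_at_top[of d]
    proof eventually_elim
      fix s assume "s \<ge> d"
      then have "s > 0" using \<open>d > 0\<close> by simp
      have "\<bar>((b s)\<^sup>2 - (a s)\<^sup>2 + (\<alpha>\<^sup>2 - \<beta>\<^sup>2)) * sin (2 * s)\<bar> \<le> \<bar>(b s)\<^sup>2 - (a s)\<^sup>2 + (\<alpha>\<^sup>2 - \<beta>\<^sup>2)\<bar>"
        unfolding abs_mult by (intro mult_left_le) auto
      moreover have "\<bar>(2 * a s * b s - 2 * \<alpha> * \<beta>) * cos (2 * s)\<bar> \<le> \<bar>2 * a s * b s - 2 * \<alpha> * \<beta>\<bar>"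
        unfolding abs_mult by (intro mult_left_le) auto
      moreover have "\<bar>3 * (z s)\<^sup>2 / s\<bar> \<le> 3 * K / s"
        using \<open>s > 0\<close> z2_le[OF \<open>s \<ge> d\<close>] by (simp add: divide_right_mono)
      ultimately show "norm (2 * s ^ 3 * jinc s * jinc_deriv s + \<rho>\<^sup>2 * sin (2 * s + 2 * \<theta>)) \<le>
        \<bar>(b s)\<^sup>2 - (a s)\<^sup>2 + (\<alpha>\<^sup>2 - \<beta>\<^sup>2)\<bar> + \<bar>2 * a s * b s - 2 * \<alpha> * \<beta>\<bar> + 3 * K / s"
        unfolding *[OF \<open>s > 0\<close>] real_norm_def by linarith
    qed
  qed
  with \<open>\<rho> > 0\<close> show ?thesis
    by (rule that)
qed

text \<open>Up to an error tending to 0, the integrand splits by product-to-sum into cosines of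
  frequencies \<open>2 * x\<close>, \<open>2 * (x - y)\<close> and \<open>2 * (x + y)\<close>. Only
  the middle one can be constant, and it is so exactly when \<open>x = y\<close>; having the same
  \<open>\<theta>\<close> in both factors then makes its value 1.\<close>

lemma jinc_product_mean:
  fixes x y \<rho> \<theta> :: real
  assumes "x > 0" "y > 0"
    and osc: "((\<lambda>s. 2 * s ^ 3 * jinc s * jinc_deriv s + \<rho>\<^sup>2 * sin (2 * s + 2 * \<theta>)) \<longlongrightarrow> 0) at_top"
  shows "((\<lambda>T. integral {1..T} (\<lambda>t. 2 * (x * t) ^ 3 * jinc (x * t) * jinc_deriv (x * t) *
      (1 - sin (2 * y * t + 2 * \<theta>))) / T) \<longlongrightarrow> (if x = y then \<rho>\<^sup>2 / 2 else 0)) at_top"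
    (is "((\<lambda>T. integral {1..T} ?h / T) \<longlongrightarrow> ?l) at_top")
proof -
  define r1 where "r1 t = (2 * (x * t) ^ 3 * jinc (x * t) * jinc_deriv (x * t) +
      \<rho>\<^sup>2 * sin (2 * (x * t) + 2 * \<theta>)) * (1 - sin (2 * y * t + 2 * \<theta>))" for t
  define r2 where "r2 t = cos (2 * x * t + (2 * \<theta> + pi / 2))" for t
  define r3 where "r3 t = cos (2 * (x - y) * t + 0)" for t
  define r4 where "r4 t = cos (2 * (x + y) * t + 4 * \<theta>)" for t
  have cont: "continuous_on S r1" "continuous_on S r2" "continuous_on S r3" "continuous_on S r4"
    for S
    unfolding r1_def r2_def r3_def r4_def by (intro continuous_intros)+
  have decomp: "?h t = r1 t + \<rho>\<^sup>2 * r2 t + \<rho>\<^sup>2 / 2 * (r3 t - r4 t)" for t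
  proof -
    have "r2 t = - sin (2 * x * t + 2 * \<theta>)"
      unfolding r2_def using minus_sin_cos_eq[of "2 * x * t + 2 * \<theta>"] by (simp add: add.assoc)
    moreover have "r3 t - r4 t = 2 * (sin (2 * x * t + 2 * \<theta>) * sin (2 * y * t + 2 * \<theta>))"
      unfolding r3_def r4_def sin_times_sin by (simp add: algebra_simps)
    ultimately show ?thesis
      unfolding r1_def by (simp add: algebra_simps)
  qed
  have "(r1 \<longlongrightarrow> 0) at_top"
  proof (rule Lim_null_comparison)
    let ?d = "\<lambda>s. 2 * s ^ 3 * jinc s * jinc_deriv s + \<rho>\<^sup>2 * sin (2 * s + 2 * \<theta>)"
    have "LIM t at_top. x * t :> at_top"
      by (rule filterlim_tendsto_pos_mult_at_top[OF tendsto_const \<open>x > 0\<close> filterlim_ident])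
    then have "((\<lambda>t. ?d (x * t)) \<longlongrightarrow> 0) at_top"
      by (rule filterlim_compose[OF osc])
    then have "((\<lambda>t. \<bar>?d (x * t)\<bar> * 2) \<longlongrightarrow> \<bar>0\<bar> * 2) at_top"
      by (intro tendsto_intros)
    then show "((\<lambda>t. \<bar>?d (x * t)\<bar> * 2) \<longlongrightarrow> 0) at_top"
      by simp
    have "\<bar>1 - sin a\<bar> \<le> 2" for a :: real
      using abs_sin_le_one[of a] by linarith
    then show "\<forall>\<^sub>F t in at_top. norm (r1 t) \<le> \<bar>?d (x * t)\<bar> * 2"
      unfolding r1_def real_norm_def abs_mult by (intro always_eventually allI mult_left_mono) auto
  qed
  then have m1: "((\<lambda>T. integral {1..T} r1 / T) \<longlongrightarrow> 0) at_top"
    by (rule tendsto_integral_mean[OF cont(1)])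
  have m2: "((\<lambda>T. integral {1..T} r2 / T) \<longlongrightarrow> 0) at_top"
    unfolding r2_def by (rule tendsto_integral_mean_cos) (use assms in auto)
  have m4: "((\<lambda>T. integral {1..T} r4 / T) \<longlongrightarrow> 0) at_top"
    unfolding r4_def by (rule tendsto_integral_mean_cos) (use assms in auto)
  have m3: "((\<lambda>T. integral {1..T} r3 / T) \<longlongrightarrow> (if x = y then 1 else 0)) at_top"
  proof (cases "x = y")
    case True
    then have "(r3 \<longlongrightarrow> 1) at_top"
      by (simp add: r3_def[abs_def])
    then show ?thesis
      using tendsto_integral_mean[OF cont(3)] True by simp
  next
    case False
    then show ?thesis
      unfolding r3_def using tendsto_integral_mean_cos[of "2 * (x - y)" 1 0] by simp
  qed
  have "integral {1..T} ?h = integral {1..T} r1 + \<rho>\<^sup>2 * integral {1..T} r2 +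
      \<rho>\<^sup>2 / 2 * (integral {1..T} r3 - integral {1..T} r4)" for T
    unfolding decomp
    by (intro integral_unique has_integral_add has_integral_mult_right has_integral_diff
        integrable_integral integrable_continuous_real cont)
  then have "(\<lambda>T. integral {1..T} ?h / T) = (\<lambda>T. integral {1..T} r1 / T +
      \<rho>\<^sup>2 * (integral {1..T} r2 / T) +
      \<rho>\<^sup>2 / 2 * (integral {1..T} r3 / T - integral {1..T} r4 / T))"
    by (simp add: add_divide_distrib mult.commute flip: diff_divide_distrib)
  moreover have "((\<lambda>T. integral {1..T} r1 / T + \<rho>\<^sup>2 * (integral {1..T} r2 / T) +
      \<rho>\<^sup>2 / 2 * (integral {1..T} r3 / T - integral {1..T} r4 / T)) \<longlongrightarrow>
      0 + \<rho>\<^sup>2 * 0 + \<rho>\<^sup>2 / 2 * ((if x = y then 1 else 0) - 0)) at_top"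
    by (intro tendsto_intros m1 m2 m3 m4)
  ultimately show ?thesis
    by (simp split: if_splits)
qed

text \<open>Test against \<open>\<Sum>\<^bsub>k\<^esub> (1 - sin (2 * k * t + 2 * \<theta>)) \<ge> 0\<close>, where \<open>k\<close> ranges over
  the distinct frequencies: in the long-time average each frequency correlates only with its own
  summand, and positively so.\<close>

lemma jinc_energy_not_decreasing:
  fixes \<omega> :: "'i \<Rightarrow> real"
  assumes "finite I" and \<omega>: "\<And>i. i \<in> I \<Longrightarrow> \<omega> i > 0"
  obtains T where "T > 0"
    and "\<And>w. (\<And>i. i \<in> I \<Longrightarrow> w i \<ge> 0) \<Longrightarrow> (\<exists>i\<in>I. w i > 0) \<Longrightarrow>
      \<exists>t\<in>{0<..<T}. (\<Sum>i\<in>I. w i * (\<omega> i * jinc (\<omega> i * t) * jinc_deriv (\<omega> i * t))) \<ge> 0"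
proof -
  obtain \<rho> \<theta> where "\<rho> > 0"
    and osc: "((\<lambda>s. 2 * s ^ 3 * jinc s * jinc_deriv s + \<rho>\<^sup>2 * sin (2 * s + 2 * \<theta>)) \<longlongrightarrow> 0) at_top"
    by (rule jinc_oscillation)
  define H where "H i t = 2 * (\<omega> i * t) ^ 3 * jinc (\<omega> i * t) * jinc_deriv (\<omega> i * t)" for i t
  define p where "p k t = 1 - sin (2 * k * t + 2 * \<theta>)" for k t :: real
  define P where "P t = (\<Sum>k\<in>\<omega> ` I. p k t)" for t
  have "p k t \<ge> 0" for k t
    by (simp add: p_def)
  then have P_nonneg: "P t \<ge> 0" for t
    unfolding P_def by (intro sum_nonneg) auto
  have cont_H: "continuous_on S (H i)" for S i
    unfolding H_def by (intro continuous_intros)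
  have cont_p: "continuous_on S (p k)" for S k
    unfolding p_def by (intro continuous_intros)
  have cont_P: "continuous_on S P" for S
    unfolding P_def by (intro continuous_intros cont_p)
  have mean: "((\<lambda>T. integral {1..T} (\<lambda>t. H i t * P t) / T) \<longlongrightarrow> \<rho>\<^sup>2 / 2) at_top" if "i \<in> I" for i
  proof -
    have "integral {1..T} (\<lambda>t. H i t * P t) / T =
        (\<Sum>k\<in>\<omega> ` I. integral {1..T} (\<lambda>t. H i t * p k t) / T)" for T
    proof -
      have "integral {1..T} (\<lambda>t. H i t * P t) =
          (\<Sum>k\<in>\<omega> ` I. integral {1..T} (\<lambda>t. H i t * p k t))"
        unfolding P_def sum_distrib_left
        by (intro integral_sum finite_imageI \<open>finite I\<close> integrable_continuous_real
            continuous_intros cont_H cont_p)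
      then show ?thesis
        by (simp add: sum_divide_distrib)
    qed
    moreover have "((\<lambda>T. \<Sum>k\<in>\<omega> ` I. integral {1..T} (\<lambda>t. H i t * p k t) / T) \<longlongrightarrow>
        (\<Sum>k\<in>\<omega> ` I. if \<omega> i = k then \<rho>\<^sup>2 / 2 else 0)) at_top"
      unfolding H_def p_def
      by (intro tendsto_sum jinc_product_mean osc) (use \<omega> that in auto)
    moreover have "(\<Sum>k\<in>\<omega> ` I. if \<omega> i = k then \<rho>\<^sup>2 / 2 else 0) = \<rho>\<^sup>2 / 2"
      using that \<open>finite I\<close> by simp
    ultimately show ?thesis
      by simp
  qed
  \<comment> \<open>\<open>T\<close> is fixed for all modes at once, before any weights are given;
    this is the source of uniformity in the starting point.\<close>
  have "\<forall>\<^sub>F T in at_top. T > 1 \<and> (\<forall>i\<in>I. integral {1..T} (\<lambda>t. H i t * P t) / T > 0)"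
    using \<open>finite I\<close> \<open>\<rho> > 0\<close>
    by (auto intro!: eventually_conj eventually_gt_at_top eventually_ball_finite
        order_tendstoD(1)[OF mean])
  then obtain T where "T > 1" and T: "\<And>i. i \<in> I \<Longrightarrow> integral {1..T} (\<lambda>t. H i t * P t) / T > 0"
    by (auto dest!: eventually_happens)
  show ?thesis
  \<comment> \<open>The added 1 puts the closed interval of integration \<open>{1..T}\<close> inside
    the open interval on which negativity is assumed.\<close>
  proof (rule that[of "T + 1"])
    show "T + 1 > 0" using \<open>T > 1\<close> by simp
    fix w :: "'i \<Rightarrow> real"
    assume w: "\<And>i. i \<in> I \<Longrightarrow> w i \<ge> 0" and ex: "\<exists>i\<in>I. w i > 0"
    let ?G = "\<lambda>t. \<Sum>i\<in>I. w i * (\<omega> i * jinc (\<omega> i * t) * jinc_deriv (\<omega> i * t))"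
    show "\<exists>t\<in>{0<..<T + 1}. ?G t \<ge> 0"
    proof (rule ccontr)
      assume "\<not> ?thesis"
      then have neg: "?G t < 0" if "t \<in> {1..T}" for t
        using that by (auto simp: not_le)
      \<comment> \<open>\<open>H i\<close> carries the cube of \<open>\<omega> i\<close> where
        \<open>?G\<close> has the first power; dividing by the square leaves the common factor
        \<open>2 * t ^ 3\<close>.\<close>
      let ?c = "\<lambda>i. w i / (\<omega> i)\<^sup>2"
      have eq: "(\<Sum>i\<in>I. ?c i * (H i t * P t)) = 2 * t ^ 3 * ?G t * P t" for t
        unfolding H_def sum_distrib_left sum_distrib_right
        using \<omega> by (intro sum.cong refl)
          (auto simp: field_simps power2_eq_square power3_eq_cube dest!: \<omega>)
      have "integral {1..T} (\<lambda>t. \<Sum>i\<in>I. ?c i * (H i t * P t)) =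
          (\<Sum>i\<in>I. integral {1..T} (\<lambda>t. ?c i * (H i t * P t)))"
        by (intro integral_sum \<open>finite I\<close> integrable_continuous_real continuous_intros cont_H cont_P)
      also have "\<dots> = (\<Sum>i\<in>I. ?c i * integral {1..T} (\<lambda>t. H i t * P t))"
        by simp
      also have "\<dots> > 0"
      proof -
        have pos: "integral {1..T} (\<lambda>t. H i t * P t) > 0" if "i \<in> I" for i
          using T[OF that] \<open>T > 1\<close> by (simp add: zero_less_divide_iff)
        obtain j where "j \<in> I" "w j > 0"
          using ex by blast
        show ?thesis
        proof (rule sum_pos2[OF \<open>finite I\<close> \<open>j \<in> I\<close>])
          show "0 < ?c j * integral {1..T} (\<lambda>t. H j t * P t)"
            using \<open>w j > 0\<close> \<omega>[OF \<open>j \<in> I\<close>] pos[OF \<open>j \<in> I\<close>] by simp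
          show "0 \<le> ?c i * integral {1..T} (\<lambda>t. H i t * P t)" if "i \<in> I" for i
            using w[OF that] pos[OF that] by simp
        qed
      qed
      finally have "integral {1..T} (\<lambda>t. 2 * t ^ 3 * ?G t * P t) > 0"
        unfolding eq .
      moreover have "integral {1..T} (\<lambda>t. 2 * t ^ 3 * ?G t * P t) \<le> integral {1..T} (\<lambda>t. 0)"
      proof (rule integral_le)
        show "(\<lambda>t. 2 * t ^ 3 * ?G t * P t) integrable_on {1..T}"
          by (intro integrable_continuous_real continuous_intros cont_P)
        show "2 * t ^ 3 * ?G t * P t \<le> 0" if "t \<in> {1..T}" for t
          using neg[OF that] P_nonneg[of t] that
          by (intro mult_nonpos_nonneg mult_nonneg_nonpos) auto
      qed (rule integrable_0)
      ultimately show False by simp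
    qed
  qed
qed

section \<open>Orthonormal eigenbases\<close>

text \<open>A maximizer \<open>e\<close> of the Rayleigh quotient on the unit sphere of
  \<open>S\<close> is an eigenvector: moving from \<open>e\<close> along its own residual
  \<open>u = A e - \<mu> e\<close>, which stays in \<open>S\<close>, would otherwise increase the
  quotient.\<close>

lemma symmetric_eigenvector:
  fixes A :: "'a::euclidean_space \<Rightarrow> 'a"
  assumes A: "linear A" and sym: "\<And>x y. A x \<bullet> y = x \<bullet> A y"
    and S: "subspace S" "A ` S \<subseteq> S" "S \<noteq> {0}"
  obtains e \<mu> where "e \<in> S" "norm e = 1" "A e = \<mu> *\<^sub>R e"
proof -
  let ?K = "S \<inter> sphere 0 1"
  obtain v where "v \<in> S" "v \<noteq> 0"
    using S subspace_0 by blast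
  then have "v /\<^sub>R norm v \<in> ?K"
    using S(1) by (simp add: subspace_scale)
  then have "?K \<noteq> {}"
    by blast
  moreover have "compact ?K"
    using closed_subspace[OF S(1)] by (intro closed_Int_compact) auto
  moreover have "continuous_on ?K (\<lambda>x. x \<bullet> A x)"
    using A by (intro continuous_intros linear_continuous_on) (simp add: linear_linear)
  ultimately obtain e where e: "e \<in> ?K" and max: "\<And>x. x \<in> ?K \<Longrightarrow> x \<bullet> A x \<le> e \<bullet> A e"
    using continuous_attains_sup[of ?K "\<lambda>x. x \<bullet> A x"] by blast
  define \<mu> where "\<mu> = e \<bullet> A e"
  have e1: "e \<in> S" "e \<bullet> e = 1"
    using e by (auto simp: norm_eq_1)
  have le: "x \<bullet> A x \<le> \<mu> * (x \<bullet> x)" if "x \<in> S" for x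
  proof (cases "x = 0")
    case False
    let ?y = "x /\<^sub>R norm x"
    have "?y \<bullet> A ?y \<le> \<mu>"
      unfolding \<mu>_def using that False S(1) by (intro max) (simp add: subspace_scale)
    moreover have "?y \<bullet> A ?y = (x \<bullet> A x) / (x \<bullet> x)"
      by (simp add: linear_cmul[OF A] dot_square_norm power2_eq_square field_simps)
    ultimately show ?thesis
      using False by (simp add: divide_le_eq)
  qed (simp add: linear_0[OF A])
  define u where "u = A e - \<mu> *\<^sub>R e"
  have "u \<in> S"
    using S e1 unfolding u_def by (auto intro!: subspace_diff subspace_scale)
  define C where "C = \<mu> * (u \<bullet> u) - u \<bullet> A u"
  have u: "u \<bullet> u = u \<bullet> A e - \<mu> * (e \<bullet> u)"
    unfolding u_def by (simp add: algebra_simps inner_commute)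
  \<comment> \<open>Maximality at \<open>e + t u\<close>, expanded in \<open>t\<close>: by the
    formula for \<open>u \<bullet> u\<close>, the linear coefficient is
    \<open>2 * (u \<bullet> u)\<close>, and \<open>C\<close> collects the quadratic terms.\<close>
  have first_order: "t * (2 * (u \<bullet> u)) \<le> t * (t * C)" for t
  proof -
    have "(e + t *\<^sub>R u) \<bullet> A (e + t *\<^sub>R u) = \<mu> + 2 * t * (u \<bullet> A e) + t * t * (u \<bullet> A u)"
      using sym[of u e]
      by (simp add: linear_add[OF A] linear_cmul[OF A] inner_commute algebra_simps \<mu>_def)
    moreover have "(e + t *\<^sub>R u) \<bullet> (e + t *\<^sub>R u) = 1 + 2 * t * (e \<bullet> u) + t * t * (u \<bullet> u)"
      using e1 inner_commute[of u e] by (simp add: inner_add_left inner_add_right algebra_simps)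
    moreover have "(e + t *\<^sub>R u) \<bullet> A (e + t *\<^sub>R u) \<le> \<mu> * ((e + t *\<^sub>R u) \<bullet> (e + t *\<^sub>R u))"
      using S(1) e1 \<open>u \<in> S\<close> by (intro le subspace_add subspace_scale)
    ultimately have "\<mu> + 2 * t * (u \<bullet> A e) + t * t * (u \<bullet> A u) \<le>
        \<mu> * (1 + 2 * t * (e \<bullet> u) + t * t * (u \<bullet> u))"
      by (simp only:)
    moreover have "t * (2 * (u \<bullet> u)) = 2 * t * (u \<bullet> A e) - \<mu> * (2 * t * (e \<bullet> u))"
      by (simp add: u right_diff_distrib)
    ultimately show ?thesis
      unfolding C_def by (simp add: right_diff_distrib distrib_left mult_ac)
  qed
  have "u \<bullet> u \<le> 0"
  proof (rule ccontr)
    assume "\<not> ?thesis"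
    then have "u \<bullet> u > 0" by (simp only: not_le)
    \<comment> \<open>Small enough that \<open>t * C\<close> is at most
      \<open>u \<bullet> u\<close>, contradicting the lower bound
      \<open>2 * (u \<bullet> u)\<close>.\<close>
    define t where "t = (u \<bullet> u) / (\<bar>C\<bar> + 1)"
    have "t > 0"
      using \<open>u \<bullet> u > 0\<close> by (simp add: t_def)
    then have "2 * (u \<bullet> u) \<le> t * C"
      using first_order[of t] by simp
    also have "\<dots> \<le> t * (\<bar>C\<bar> + 1)"
      using \<open>t > 0\<close> by (intro mult_left_mono) auto
    also have "\<dots> = u \<bullet> u"
      unfolding t_def by (simp add: add_nonneg_eq_0_iff)
    finally show False
      using \<open>u \<bullet> u > 0\<close> by simp
  qed
  then have "u = 0"
    using inner_ge_zero[of u] by (metis antisym inner_eq_zero_iff)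
  then have "A e = \<mu> *\<^sub>R e"
    by (simp add: u_def)
  then show ?thesis
    using e by (intro that[of e \<mu>]) auto
qed

text \<open>Induction on the dimension: symmetry makes the orthogonal complement of an eigenvector
  within \<open>S\<close> invariant again. The statement is relative to \<open>S\<close> so that the
  hypothesis applies to this complement.\<close>

lemma symmetric_eigenbasis_subspace:
  fixes A :: "'a::euclidean_space \<Rightarrow> 'a"
  assumes A: "linear A" and sym: "\<And>x y. A x \<bullet> y = x \<bullet> A y"
    and S: "subspace S" "A ` S \<subseteq> S"
  shows "\<exists>B. finite B \<and> B \<subseteq> S \<and> (\<forall>e\<in>B. \<forall>e'\<in>B. e \<bullet> e' = (if e = e' then 1 else 0)) \<and>
    (\<forall>x\<in>S. x = (\<Sum>e\<in>B. (x \<bullet> e) *\<^sub>R e)) \<and> (\<forall>e\<in>B. \<exists>\<mu>. A e = \<mu> *\<^sub>R e)"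
  using S
proof (induction "dim S" arbitrary: S)
  case 0
  have "S \<subseteq> {0}" using "0.hyps" dim_eq_0[of S] by simp
  then show ?case by (intro exI[of _ "{}"]) auto
next
  case (Suc n)
  then have "S \<noteq> {0}" by auto
  then obtain e \<mu> where e: "e \<in> S" "norm e = 1" "A e = \<mu> *\<^sub>R e"
    using symmetric_eigenvector[OF A sym \<open>subspace S\<close> \<open>A ` S \<subseteq> S\<close>] by metis
  have ee: "e \<bullet> e = 1"
    using e(2) by (simp add: norm_eq_1)
  define S' where "S' = {y \<in> S. \<forall>x\<in>span {e}. orthogonal x y}"
  have S'_iff: "y \<in> S' \<longleftrightarrow> y \<in> S \<and> e \<bullet> y = 0" for y
    by (auto simp: S'_def span_singleton orthogonal_def)
  have "span {e} \<subseteq> S"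
    using e(1) Suc.prems(1) by (simp add: span_minimal)
  then have "dim S' + dim (span {e}) = dim S"
    unfolding S'_def by (intro dim_subspace_orthogonal_to_vectors Suc.prems subspace_span)
  moreover have "dim (span {e}) = 1"
    using e(2) by (auto simp: dim_singleton)
  ultimately have n: "n = dim S'"
    using Suc.hyps(2) by simp
  have sub: "subspace S'"
    using Suc.prems(1) unfolding subspace_def by (auto simp: S'_iff inner_add_right)
  have inv: "A ` S' \<subseteq> S'"
  proof
    fix y assume "y \<in> A ` S'"
    then obtain x where "y = A x" "x \<in> S" "e \<bullet> x = 0"
      by (auto simp: S'_iff)
    then show "y \<in> S'"
      using sym[of e x] e(3) Suc.prems(2) by (auto simp: S'_iff)
  qed
  obtain B where B: "finite B" "B \<subseteq> S'"
    "\<forall>u\<in>B. \<forall>v\<in>B. u \<bullet> v = (if u = v then 1 else 0)"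
    "\<forall>x\<in>S'. x = (\<Sum>u\<in>B. (x \<bullet> u) *\<^sub>R u)"
    "\<forall>u\<in>B. \<exists>\<mu>. A u = \<mu> *\<^sub>R u"
    using Suc.hyps(1)[OF n sub inv] by (elim exE conjE) (rule that)
  have eB: "e \<bullet> u = 0" "u \<bullet> e = 0" if "u \<in> B" for u
    using that B(2) by (auto simp: S'_iff inner_commute)
  have "e \<notin> B"
    using eB(1)[of e] ee by auto
  have expand: "x = (\<Sum>u\<in>insert e B. (x \<bullet> u) *\<^sub>R u)" if "x \<in> S" for x
  proof -
    let ?y = "x - (x \<bullet> e) *\<^sub>R e"
    have "?y \<in> S'"
      using that e(1) ee Suc.prems(1)
      by (simp add: S'_iff subspace_diff subspace_scale inner_diff_right inner_commute)
    then have "?y = (\<Sum>u\<in>B. (?y \<bullet> u) *\<^sub>R u)"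
      by (rule B(4)[rule_format])
    also have "\<dots> = (\<Sum>u\<in>B. (x \<bullet> u) *\<^sub>R u)"
      by (intro sum.cong refl) (simp add: inner_diff_left eB)
    finally show ?thesis
      using \<open>finite B\<close> \<open>e \<notin> B\<close> by (simp add: algebra_simps)
  qed
  show ?case
  proof (intro exI[of _ "insert e B"] conjI)
    show "finite (insert e B)" using B by simp
    show "insert e B \<subseteq> S" using B(2) e(1) by (auto simp: S'_iff)
    show "\<forall>u\<in>insert e B. \<forall>v\<in>insert e B. u \<bullet> v = (if u = v then 1 else 0)"
      using B(3) eB ee \<open>e \<notin> B\<close> by auto
    show "\<forall>x\<in>S. x = (\<Sum>u\<in>insert e B. (x \<bullet> u) *\<^sub>R u)"
      using expand by blast
    show "\<forall>u\<in>insert e B. \<exists>\<mu>. A u = \<mu> *\<^sub>R u"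
      using B(5) e(3) by auto
  qed
qed

text \<open>Eigenvalues are recorded as squares because their roots are the frequencies in
  \<open>jinc (\<omega> * t)\<close>. For a unit eigenvector the eigenvalue is
  \<open>e \<bullet> A e\<close>, which semidefiniteness makes nonnegative.\<close>

lemma psd_eigenbasis:
  fixes A :: "'a::euclidean_space \<Rightarrow> 'a"
  assumes A: "linear A" and sym: "\<And>x y. A x \<bullet> y = x \<bullet> A y" and psd: "\<And>x. 0 \<le> x \<bullet> A x"
  obtains B \<omega> where "finite B" "\<And>e e'. e \<in> B \<Longrightarrow> e' \<in> B \<Longrightarrow> e \<bullet> e' = (if e = e' then 1 else 0)"
    "\<And>x. x = (\<Sum>e\<in>B. (x \<bullet> e) *\<^sub>R e)" "\<And>e. e \<in> B \<Longrightarrow> A e = (\<omega> e)\<^sup>2 *\<^sub>R e"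
    "\<And>e. e \<in> B \<Longrightarrow> 0 \<le> \<omega> e"
proof -
  have "A ` UNIV \<subseteq> UNIV" by simp
  from symmetric_eigenbasis_subspace[OF A sym subspace_UNIV this]
  obtain B where B: "finite B" "\<forall>e\<in>B. \<forall>e'\<in>B. e \<bullet> e' = (if e = e' then 1 else 0)"
    "\<forall>x\<in>UNIV. x = (\<Sum>e\<in>B. (x \<bullet> e) *\<^sub>R e)" "\<forall>e\<in>B. \<exists>\<mu>. A e = \<mu> *\<^sub>R e"
    by (elim exE conjE) (rule that)
  show ?thesis
  proof (rule that[of B "\<lambda>e. sqrt (e \<bullet> A e)"])
    show "finite B"
      by (rule B(1))
    show "e \<bullet> e' = (if e = e' then 1 else 0)" if "e \<in> B" "e' \<in> B" for e e'
      using B(2) that by blast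
    show "x = (\<Sum>e\<in>B. (x \<bullet> e) *\<^sub>R e)" for x
      by (rule B(3)[rule_format, OF UNIV_I])
    fix e assume "e \<in> B"
    then obtain \<mu> where "A e = \<mu> *\<^sub>R e"
      using B(4) by blast
    moreover have "e \<bullet> e = 1"
      using B(2) \<open>e \<in> B\<close> by simp
    ultimately show "A e = (sqrt (e \<bullet> A e))\<^sup>2 *\<^sub>R e"
      using psd[of e] by simp
    show "0 \<le> sqrt (e \<bullet> A e)"
      using psd[of e] by simp
  qed
qed

section \<open>The accelerated gradient flow of a quadratic\<close>

lemma DERIV_scaled_jinc:
  "((\<lambda>t. jinc (\<omega> * t)) has_real_derivative \<omega> * jinc_deriv (\<omega> * t)) (at t)"
  using DERIV_chain2[OF DERIV_jinc DERIV_cmult[OF DERIV_ident], of \<omega> t] by (simp add: mult.commute)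

lemma DERIV_scaled_jinc_deriv:
  assumes "t > 0"
  shows "((\<lambda>t. \<omega> * jinc_deriv (\<omega> * t)) has_real_derivative
    - (3 / t) * (\<omega> * jinc_deriv (\<omega> * t)) - \<omega>\<^sup>2 * jinc (\<omega> * t)) (at t)"
\<comment> \<open>At frequency 0 the argument of \<open>jinc_deriv\<close> is the singular point of
  its equation for every \<open>t\<close>, but both sides are then 0.\<close>
proof (cases "\<omega> = 0")
  case False
  then have "\<omega> * t \<noteq> 0" using assms by simp
  have "((\<lambda>t. jinc_deriv (\<omega> * t)) has_real_derivative
      (- (3 / (\<omega> * t)) * jinc_deriv (\<omega> * t) - jinc (\<omega> * t)) * (\<omega> * 1)) (at t)"
    by (rule DERIV_chain2[OF DERIV_jinc_deriv[OF \<open>\<omega> * t \<noteq> 0\<close>] DERIV_cmult[OF DERIV_ident]])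
  from DERIV_cmult[OF this, of \<omega>] show ?thesis
    by (rule DERIV_cong) (use False assms in \<open>simp add: field_simps power2_eq_square\<close>)
qed simp

lemma has_vector_derivative_cmult_scaleR:
  assumes "(g has_real_derivative g') (at t)"
  shows "((\<lambda>t. (c * g t) *\<^sub>R v) has_vector_derivative (c * g') *\<^sub>R v) (at t)"
  using has_vector_derivative_scaleR[OF DERIV_cmult[OF assms, of c] has_vector_derivative_const[of v]]
  by simp

text \<open>\<open>p\<close> is a fixed minimizer, since \<open>A p = - b\<close> says that the
  gradient vanishes there; all coordinates are taken relative to it. Semidefiniteness is encoded by
  eigenvalues that are squares.\<close>

locale quadratic =
  fixes A :: "'a::euclidean_space \<Rightarrow> 'a" and b :: 'a and f :: "'a \<Rightarrow> real" and p :: 'a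
    and B :: "'a set" and \<omega> :: "'a \<Rightarrow> real"
  assumes A_linear: "linear A" and A_sym: "A x \<bullet> y = x \<bullet> A y"
    and f_eq: "f = (\<lambda>x. 1 / 2 * (x \<bullet> A x) + b \<bullet> x)" and A_p: "A p = - b"
    and finite_B: "finite B"
    and orthonormal: "e \<in> B \<Longrightarrow> e' \<in> B \<Longrightarrow> e \<bullet> e' = (if e = e' then 1 else 0)"
    and expand: "x = (\<Sum>e\<in>B. (x \<bullet> e) *\<^sub>R e)"
    and A_eigen: "e \<in> B \<Longrightarrow> A e = (\<omega> e)\<^sup>2 *\<^sub>R e"
    and \<omega>_nonneg: "e \<in> B \<Longrightarrow> 0 \<le> \<omega> e"
begin

section \<open>Eigencoordinates, the gradient and the optimality gap\<close>

lemma inner_basis_sum: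
  assumes "e \<in> B"
  shows "(\<Sum>e'\<in>B. c e' *\<^sub>R e') \<bullet> e = c e"
proof -
  have "(\<Sum>e'\<in>B. c e' *\<^sub>R e') \<bullet> e = (\<Sum>e'\<in>B. if e' = e then c e' else 0)"
    unfolding inner_sum_left by (intro sum.cong refl) (auto simp: orthonormal assms)
  then show ?thesis
    using assms finite_B by simp
qed

lemma inner_eq_basis_sum: "x \<bullet> y = (\<Sum>e\<in>B. (x \<bullet> e) * (y \<bullet> e))"
proof -
  have "x \<bullet> y = (\<Sum>e\<in>B. (x \<bullet> e) *\<^sub>R e) \<bullet> y"
    using expand[of x] by simp
  then show ?thesis
    by (simp add: inner_sum_left inner_commute[of y])
qed

lemma A_inner_basis: "e \<in> B \<Longrightarrow> A x \<bullet> e = (\<omega> e)\<^sup>2 * (x \<bullet> e)"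
  by (simp add: A_sym A_eigen)

lemma A_diff: "A (x - y) = A x - A y"
  by (rule linear_diff[OF A_linear])

lemma gderiv_f: "GDERIV f x :> A (x - p)"
proof -
  have "bounded_linear A"
    using A_linear by (simp add: linear_linear)
  then have "(f has_derivative (\<lambda>h. 1 / 2 * (x \<bullet> A h + h \<bullet> A x) + b \<bullet> h)) (at x)"
    unfolding f_eq
    by (auto intro!: derivative_eq_intros bounded_linear.has_derivative[OF \<open>bounded_linear A\<close>])
  moreover have "1 / 2 * (x \<bullet> A h + h \<bullet> A x) + b \<bullet> h = h \<bullet> A (x - p)" for h
    using A_sym[of x h] by (simp add: A_diff A_p inner_commute inner_add_right)
  ultimately show ?thesis
    unfolding gderiv_def by simp
qed

lemma gradient_f: "gradient f x = A (x - p)"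
  unfolding gradient_def
proof (rule the_equality)
  show "GDERIV f x :> A (x - p)"
    by (rule gderiv_f)
  fix D assume "GDERIV f x :> D"
  then have "(\<lambda>h. h \<bullet> D) = (\<lambda>h. h \<bullet> A (x - p))"
    using gderiv_f[of x] unfolding gderiv_def by (rule has_derivative_unique)
  then have "h \<bullet> D = h \<bullet> A (x - p)" for h
    by (rule fun_cong)
  then show "D = A (x - p)"
    by (subst vector_eq_ldot[symmetric]) blast
qed

text \<open>This is \<open>f x - f p\<close>, by \<open>f_eq_gap\<close>, written so that each mode
  and its decay are visible; kernel coordinates do not enter.\<close>

definition gap :: "'a \<Rightarrow> real" where
  "gap x = 1 / 2 * (\<Sum>e\<in>B. (\<omega> e)\<^sup>2 * ((x - p) \<bullet> e)\<^sup>2)"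

lemma gap_nonneg: "0 \<le> gap x"
  unfolding gap_def by (intro mult_nonneg_nonneg sum_nonneg) auto

lemma f_eq_gap: "f x = f p + gap x"
proof -
  have "2 * gap x = (x - p) \<bullet> A (x - p)"
    unfolding gap_def inner_eq_basis_sum[of "x - p" "A (x - p)"]
    by (simp add: A_inner_basis power2_eq_square mult_ac)
  moreover have "A x \<bullet> p = - (b \<bullet> x)"
    using A_sym[of x p] by (simp only: A_p) (simp add: inner_commute)
  then have "(x - p) \<bullet> A (x - p) = x \<bullet> A x + 2 * (b \<bullet> x) - b \<bullet> p"
    by (simp add: A_diff A_p inner_diff_left inner_add_right inner_commute[of p] inner_commute[of x b])
  moreover have "p \<bullet> A p = - (b \<bullet> p)"
    by (simp add: A_p inner_commute)
  ultimately show ?thesis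
    unfolding f_eq by simp
qed

lemma minimizer_iff: "minimizer f x \<longleftrightarrow> gap x = 0"
proof
  assume "minimizer f x"
  then have "\<not> f p < f x"
    by (simp add: is_arg_min_def)
  then show "gap x = 0"
    using f_eq_gap[of x] gap_nonneg[of x] by simp
next
  assume "gap x = 0"
  then show "minimizer f x"
    using gap_nonneg by (simp add: is_arg_min_def not_less) (metis add.right_neutral f_eq_gap le_add_same_cancel1)
qed

lemma Inf_f: "(INF x. f x) = f p"
proof (rule cInf_eq_minimum)
  fix y assume "y \<in> range f"
  then obtain x where "y = f x" by blast
  then show "f p \<le> y"
    using f_eq_gap[of x] gap_nonneg[of x] by simp
qed simp

section \<open>The explicit flow and its uniqueness\<close>

definition flow :: "'a \<Rightarrow> real \<Rightarrow> 'a" where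
  "flow r t = p + (\<Sum>e\<in>B. (((r - p) \<bullet> e) * jinc (\<omega> e * t)) *\<^sub>R e)"

definition flow_deriv :: "'a \<Rightarrow> real \<Rightarrow> 'a" where
  "flow_deriv r t = (\<Sum>e\<in>B. (((r - p) \<bullet> e) * (\<omega> e * jinc_deriv (\<omega> e * t))) *\<^sub>R e)"

lemma flow_inner: "e \<in> B \<Longrightarrow> (flow r t - p) \<bullet> e = ((r - p) \<bullet> e) * jinc (\<omega> e * t)"
  by (simp add: flow_def inner_basis_sum)

lemma flow_deriv_inner:
  "e \<in> B \<Longrightarrow> flow_deriv r t \<bullet> e = ((r - p) \<bullet> e) * (\<omega> e * jinc_deriv (\<omega> e * t))"
  by (simp add: flow_deriv_def inner_basis_sum)

lemma flow_0 [simp]: "flow r 0 = r"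
  using expand[of "r - p"] by (simp add: flow_def)

lemma flow_has_vector_derivative: "(flow r has_vector_derivative flow_deriv r t) (at t)"
proof -
  have "(flow r has_vector_derivative 0 + flow_deriv r t) (at t)"
    unfolding flow_def[abs_def] flow_deriv_def
    by (intro has_vector_derivative_add has_vector_derivative_const has_vector_derivative_sum
        has_vector_derivative_cmult_scaleR DERIV_scaled_jinc)
  then show ?thesis by simp
qed

lemma flow_deriv_has_vector_derivative:
  assumes "t > 0"
  shows "(flow_deriv r has_vector_derivative
    - (3 / t) *\<^sub>R flow_deriv r t - A (flow r t - p)) (at t)"
proof -
  have "(flow_deriv r has_vector_derivative
    (\<Sum>e\<in>B. (((r - p) \<bullet> e) * (- (3 / t) * (\<omega> e * jinc_deriv (\<omega> e * t)) -
       (\<omega> e)\<^sup>2 * jinc (\<omega> e * t))) *\<^sub>R e)) (at t)" (is "(_ has_vector_derivative ?D) _")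
    unfolding flow_deriv_def[abs_def]
    by (intro has_vector_derivative_sum has_vector_derivative_cmult_scaleR
        DERIV_scaled_jinc_deriv[OF assms])
  moreover have "?D = - (3 / t) *\<^sub>R flow_deriv r t - A (flow r t - p)"
  proof -
    let ?R = "- (3 / t) *\<^sub>R flow_deriv r t - A (flow r t - p)"
    have "?D = (\<Sum>e\<in>B. (?R \<bullet> e) *\<^sub>R e)"
    proof (intro sum.cong refl arg_cong2[where f = scaleR])
      fix e assume "e \<in> B"
      then have "?R \<bullet> e = - (3 / t) * (((r - p) \<bullet> e) * (\<omega> e * jinc_deriv (\<omega> e * t))) -
          (\<omega> e)\<^sup>2 * (((r - p) \<bullet> e) * jinc (\<omega> e * t))"
        by (subst inner_diff_left) (simp only: inner_scaleR_left flow_deriv_inner A_inner_basis flow_inner)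
      then show "((r - p) \<bullet> e) * (- (3 / t) * (\<omega> e * jinc_deriv (\<omega> e * t)) -
          (\<omega> e)\<^sup>2 * jinc (\<omega> e * t)) = ?R \<bullet> e"
        by (simp only: right_diff_distrib mult_ac)
    qed
    then show ?thesis
      using expand[of ?R] by simp
  qed
  ultimately show ?thesis by simp
qed

lemma flow_is_ode_solution: "is_ode_solution f r (flow r)"
  unfolding is_ode_solution_def
proof (intro exI[of _ "flow_deriv r"] conjI allI impI)
  show "(flow r has_vector_derivative flow_deriv r t) (at t within {0..})" for t
    by (rule has_vector_derivative_at_within[OF flow_has_vector_derivative])
  show "continuous_on {0..} (flow_deriv r)"
    unfolding flow_deriv_def by (intro continuous_intros)
  show "flow_deriv r 0 = 0"
    by (simp add: flow_deriv_def)
  show "\<exists>W. (flow_deriv r has_vector_derivative W) (at t) \<and>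
      W + (3 / t) *\<^sub>R flow_deriv r t + gradient f (flow r t) = 0" if "t > 0" for t
    by (intro exI conjI, rule flow_deriv_has_vector_derivative[OF that]) (simp add: gradient_f)
qed simp

text \<open>Energy argument: for the difference \<open>D\<close> of two solutions, \<open>\<bar>D'\<bar>\<^sup>2 + D \<bullet> A D\<close> is
  nonincreasing and starts at zero.\<close>

lemma ode_solution_unique:
  assumes "is_ode_solution f r X" and "t \<ge> 0"
  shows "X t = flow r t"
proof -
  from assms(1) obtain V where V:
    "(\<forall>t\<ge>0. (X has_vector_derivative V t) (at t within {0..})) \<and>
      continuous_on {0..} V \<and> X 0 = r \<and> V 0 = 0 \<and>
      (\<forall>t>0. \<exists>W. (V has_vector_derivative W) (at t) \<and>
        W + (3 / t) *\<^sub>R V t + gradient f (X t) = 0)"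
    unfolding is_ode_solution_def by (rule exE)
  note X' = V[THEN conjunct1] and V_cont = V[THEN conjunct2, THEN conjunct1]
    and X0 = V[THEN conjunct2, THEN conjunct2, THEN conjunct1]
    and V0 = V[THEN conjunct2, THEN conjunct2, THEN conjunct2, THEN conjunct1]
    and ode = V[THEN conjunct2, THEN conjunct2, THEN conjunct2, THEN conjunct2, unfolded gradient_f]
  define D where "D t = X t - flow r t" for t
  define W where "W t = V t - flow_deriv r t" for t
  define E where "E t = W t \<bullet> W t + D t \<bullet> A (D t)" for t
  have A_bl: "bounded_linear A"
    using A_linear by (simp add: linear_linear)
  have D': "(D has_vector_derivative W t) (at t within {0..})" if "t \<ge> 0" for t
    unfolding D_def[abs_def] W_def
    by (rule has_vector_derivative_diff[OF X'[rule_format, OF that]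
          has_vector_derivative_at_within[OF flow_has_vector_derivative]])
  have D_at: "(D has_vector_derivative W t) (at t)" if "t > 0" for t
  proof -
    have "at t within {0..} = at t"
      by (rule at_within_open_subset[of _ "{0<..}"]) (use that in auto)
    then show ?thesis
      using D'[OF less_imp_le[OF that]] by simp
  qed
  have D_cont: "continuous_on {0..} D"
    unfolding continuous_on_eq_continuous_within
    by (auto intro: has_vector_derivative_continuous[OF D'])
  have W_cont: "continuous_on {0..} W"
    unfolding W_def[abs_def] flow_deriv_def by (intro continuous_intros V_cont)
  have W_at: "(W has_vector_derivative - (3 / t) *\<^sub>R W t - A (D t)) (at t)" if "t > 0" for t
  proof -
    obtain V' where "(V has_vector_derivative V') (at t)" and V': "V' + (3 / t) *\<^sub>R V t + A (X t - p) = 0"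
      using ode \<open>t > 0\<close> by blast
    then have "(W has_vector_derivative
        V' - (- (3 / t) *\<^sub>R flow_deriv r t - A (flow r t - p))) (at t)"
      unfolding W_def[abs_def] by (intro has_vector_derivative_diff flow_deriv_has_vector_derivative that)
    moreover have "V' = - (3 / t) *\<^sub>R V t - A (X t - p)"
      using V' by (simp add: algebra_simps eq_neg_iff_add_eq_0)
    ultimately show ?thesis
      by (simp add: W_def D_def A_diff algebra_simps)
  qed
  have E_le: "E t \<le> E 0" if "t \<ge> 0" for t
  \<comment> \<open>The equation holds only for positive times, so the endpoint 0 enters by
    continuity of \<open>E\<close>.\<close>
  proof (rule DERIV_nonpos_imp_decreasing_open[OF that])
    fix s :: real assume "0 < s" "s < t"
    have "(E has_real_derivative
        W s \<bullet> (- (3 / s) *\<^sub>R W s - A (D s)) + (- (3 / s) *\<^sub>R W s - A (D s)) \<bullet> W s +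
        (D s \<bullet> A (W s) + W s \<bullet> A (D s))) (at s)"
      unfolding E_def[abs_def] has_real_derivative_iff_has_vector_derivative
      by (intro has_vector_derivative_add
          bounded_bilinear.has_vector_derivative[OF bounded_bilinear_inner]
          bounded_linear.has_vector_derivative[OF A_bl] D_at W_at \<open>0 < s\<close>)
    moreover have "W s \<bullet> (- (3 / s) *\<^sub>R W s - A (D s)) + (- (3 / s) *\<^sub>R W s - A (D s)) \<bullet> W s +
        (D s \<bullet> A (W s) + W s \<bullet> A (D s)) = - (6 / s) * (W s \<bullet> W s)"
      using A_sym[of "D s" "W s"] by (simp add: inner_diff_left inner_diff_right inner_commute)
    moreover have "- (6 / s) * (W s \<bullet> W s) \<le> 0"
      using \<open>0 < s\<close> by simp
    ultimately show "\<exists>y. (E has_real_derivative y) (at s) \<and> y \<le> 0"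
      by auto
  next
    have "continuous_on {0..t} D" "continuous_on {0..t} W"
      using D_cont W_cont by (auto intro: continuous_on_subset)
    then show "continuous_on {0..t} E"
      unfolding E_def[abs_def]
      by (intro continuous_intros linear_continuous_on_compose[OF _ A_linear])
  qed
  have psd: "0 \<le> x \<bullet> A x" for x
  proof -
    have "x \<bullet> A x = (\<Sum>e\<in>B. (\<omega> e * (x \<bullet> e))\<^sup>2)"
      unfolding inner_eq_basis_sum[of x "A x"]
      by (intro sum.cong refl) (simp add: A_inner_basis power2_eq_square)
    then show ?thesis
      by (simp add: sum_nonneg)
  qed
  have "D 0 = 0" "W 0 = 0"
    using X0 V0 by (simp_all add: D_def W_def flow_deriv_def)
  \<comment> \<open>\<open>A\<close> may have a kernel, so vanishing of \<open>E\<close> does not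
    force \<open>D\<close> to vanish. It forces the velocity \<open>W\<close> to vanish, and
    \<open>D\<close> is then constant with initial value 0.\<close>
  have "W t = 0" if "t \<ge> 0" for t
  proof -
    have "E t \<le> 0"
      using E_le[OF that] \<open>D 0 = 0\<close> \<open>W 0 = 0\<close> by (simp add: E_def)
    then have "W t \<bullet> W t \<le> 0"
      using psd[of "D t"] unfolding E_def by linarith
    then show ?thesis
      by (metis antisym inner_eq_zero_iff inner_ge_zero)
  qed
  then have "(D has_vector_derivative 0) (at t within {0..})" if "t \<in> {0..}" for t
    using D'[of t] that by simp
  then obtain c where "\<And>t. t \<in> {0..} \<Longrightarrow> D t = c"
    using has_vector_derivative_zero_constant[of "{0..}" D] by (metis convex_real_interval(1))
  then have "D t = D 0"
    using \<open>t \<ge> 0\<close> by simp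
  then show ?thesis
    using \<open>D 0 = 0\<close> by (simp add: D_def)
qed

text \<open>On nonnegative times the arbitrary choice made by \<open>SOME\<close> is harmless:
  \<open>flow r\<close> shows that a solution exists, and all solutions agree with it there.\<close>

lemma ode_solution_eq_flow: "t \<ge> 0 \<Longrightarrow> ode_solution f r t = flow r t"
  unfolding ode_solution_def
  by (rule ode_solution_unique[OF someI[where P = "is_ode_solution f r"]])
    (rule flow_is_ode_solution)

section \<open>The restart criterion in eigencoordinates\<close>

lemma vector_derivative_ode_solution:
  assumes "t > 0"
  shows "vector_derivative (ode_solution f r) (at t) = flow_deriv r t"
proof (rule vector_derivative_at)
  show "(ode_solution f r has_vector_derivative flow_deriv r t) (at t)"
    by (rule has_vector_derivative_transform_within_open[OF flow_has_vector_derivative[of r t],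
          where S = "{0<..}"]) (use assms in \<open>auto simp: ode_solution_eq_flow\<close>)
qed

text \<open>One expression in two roles: the inner product tested by the restart rule
  (\<open>rate_eq\<close>) and the time derivative of the gap (\<open>DERIV_gap_flow\<close>). Hence
  the gap decreases until the restart.\<close>

definition rate :: "'a \<Rightarrow> real \<Rightarrow> real" where
  "rate r t = (\<Sum>e\<in>B. ((\<omega> e)\<^sup>2 * ((r - p) \<bullet> e)\<^sup>2) *
    (\<omega> e * jinc (\<omega> e * t) * jinc_deriv (\<omega> e * t)))"

lemma rate_eq:
  "t > 0 \<Longrightarrow> gradient f (ode_solution f r t) \<bullet> vector_derivative (ode_solution f r) (at t) = rate r t"
  unfolding rate_def
  by (subst inner_eq_basis_sum)
    (simp add: ode_solution_eq_flow vector_derivative_ode_solution gradient_f A_inner_basis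
      flow_inner flow_deriv_inner power2_eq_square mult_ac)

lemma gap_flow: "gap (flow r t) =
    1 / 2 * (\<Sum>e\<in>B. ((\<omega> e)\<^sup>2 * ((r - p) \<bullet> e)\<^sup>2) * (jinc (\<omega> e * t))\<^sup>2)"
  unfolding gap_def by (simp add: flow_inner power_mult_distrib mult.assoc)

lemma DERIV_gap_flow: "((\<lambda>t. gap (flow r t)) has_real_derivative rate r t) (at t)"
proof -
  have "((\<lambda>t. gap (flow r t)) has_real_derivative 1 / 2 *
    (\<Sum>e\<in>B. ((\<omega> e)\<^sup>2 * ((r - p) \<bullet> e)\<^sup>2) *
      (2 * jinc (\<omega> e * t) * (\<omega> e * jinc_deriv (\<omega> e * t))))) (at t)"
    unfolding gap_flow
    by (intro DERIV_cmult DERIV_sum DERIV_cong[OF DERIV_power[OF DERIV_scaled_jinc]])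
      (simp add: mult_ac)
  then show ?thesis
    by (rule DERIV_cong) (simp add: rate_def sum_distrib_left mult_ac)
qed

lemma gr_restart_time_eq:
  "gr_restart_time f r = Sup (ennreal ` {t. t > 0 \<and> (\<forall>u\<in>{0<..<t}. rate r u < 0)})"
proof -
  have "{t. t > 0 \<and> (\<forall>u\<in>{0<..<t}. gradient f (ode_solution f r u) \<bullet>
      vector_derivative (ode_solution f r) (at u) < 0)} =
    {t. t > 0 \<and> (\<forall>u\<in>{0<..<t}. rate r u < 0)}"
    by (intro Collect_cong conj_cong ball_cong refl) (simp add: rate_eq)
  then show ?thesis
    by (simp only: gr_restart_time_def)
qed

end

section \<open>Restart times\<close>

lemma Sup_ennreal_image:
  fixes S :: "real set"
  assumes "S \<noteq> {}" "bdd_above S" "\<And>x. x \<in> S \<Longrightarrow> 0 \<le> x"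
  shows "Sup (ennreal ` S) = ennreal (Sup S)"
proof (rule antisym)
  show "Sup (ennreal ` S) \<le> ennreal (Sup S)"
    using assms by (auto intro!: SUP_least ennreal_leI cSup_upper)
  show "ennreal (Sup S) \<le> Sup (ennreal ` S)"
  proof (rule ccontr)
    assume "\<not> ?thesis"
    then have "Sup (ennreal ` S) < ennreal (Sup S)"
      by simp
    then obtain c where c: "Sup (ennreal ` S) = ennreal c" "0 \<le> c"
      by (metis ennreal_cases ennreal_less_top order_less_asym)
    then have "c < Sup S"
      using \<open>Sup (ennreal ` S) < ennreal (Sup S)\<close> by (simp add: ennreal_less_iff)
    then obtain x where "x \<in> S" "c < x"
      using assms by (auto simp: less_cSup_iff)
    then have "ennreal c < ennreal x"
      using \<open>0 \<le> c\<close> by (simp add: ennreal_less_iff)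
    also have "ennreal x \<le> Sup (ennreal ` S)"
      using \<open>x \<in> S\<close> by (intro Sup_upper) auto
    finally show False
      using c by simp
  qed
qed

context quadratic
begin

text \<open>All constants are chosen before \<open>r\<close>. Up to \<open>tmin\<close> every mode
  of positive frequency is still in the initial descent of \<open>jinc\<close>, which bounds restart
  times below and contracts the gap by \<open>q\<close>; \<open>jinc_energy_not_decreasing\<close>
  bounds them above.\<close>

lemma restart_bounds:
  obtains tmin tmax q where "0 < tmin" "tmin \<le> tmax" "0 < q" "q < 1"
    and "\<And>r. \<exists>T. 0 \<le> T \<and> T \<le> tmax \<and> (\<not> minimizer f r \<longrightarrow> tmin \<le> T) \<and>
      gr_restart_time f r = ennreal T \<and> (\<forall>t\<in>{0..T}. gap (flow r t) \<le> gap r) \<and>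
      gap (flow r T) \<le> q * gap r"
proof -
  define I where "I = {e \<in> B. \<omega> e > 0}"
  have "finite I" using finite_B by (simp add: I_def)
  obtain d where "d > 0" and d_pos: "\<And>s. 0 \<le> s \<Longrightarrow> s \<le> d \<Longrightarrow> jinc s > 0"
    and d_neg: "\<And>s. 0 < s \<Longrightarrow> s \<le> d \<Longrightarrow> jinc_deriv s < 0"
    using jinc_initial_descent by metis
  \<comment> \<open>A crude bound on all frequencies; the 1 keeps it positive when all of them
    vanish.\<close>
  define M where "M = 1 + sum \<omega> B"
  have "M > 0"
    unfolding M_def using \<omega>_nonneg by (intro add_pos_nonneg sum_nonneg) auto
  have \<omega>_le: "\<omega> e \<le> M" if "e \<in> B" for e
    using member_le_sum[OF that, of \<omega>] \<omega>_nonneg finite_B by (simp add: M_def)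
  define tmin where "tmin = d / M"
  have "tmin > 0"
    using \<open>d > 0\<close> \<open>M > 0\<close> by (simp add: tmin_def)
  have scaled_le: "\<omega> e * t \<le> d" if "e \<in> B" "0 \<le> t" "t \<le> tmin" for e t
  proof -
    have "\<omega> e * t \<le> M * tmin"
      using that \<omega>_le \<open>M > 0\<close> by (intro mult_mono) auto
    then show ?thesis
      using \<open>M > 0\<close> by (simp add: tmin_def)
  qed
  have sq_less: "(jinc (\<omega> e * tmin))\<^sup>2 < 1" if "e \<in> I" for e
  proof -
    have e: "e \<in> B" "\<omega> e > 0" using that by (auto simp: I_def)
    have "jinc (\<omega> e * tmin) < jinc 0"
    proof (rule DERIV_neg_imp_decreasing_open[of 0 "\<omega> e * tmin" jinc])
      show "0 < \<omega> e * tmin" using e \<open>tmin > 0\<close> by simp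
      show "\<exists>y. (jinc has_real_derivative y) (at x) \<and> y < 0"
        if "0 < x" "x < \<omega> e * tmin" for x
        using DERIV_jinc[of x] d_neg[of x] scaled_le[OF e(1), of tmin] that \<open>tmin > 0\<close> by force
      show "continuous_on {0..\<omega> e * tmin} jinc"
        by (rule continuous_on_jinc) (rule continuous_on_id)
    qed
    moreover have "0 < jinc (\<omega> e * tmin)"
      using d_pos[of "\<omega> e * tmin"] scaled_le[OF e(1), of tmin] e \<open>tmin > 0\<close> by simp
    ultimately show ?thesis
      by (simp add: power_less_one_iff abs_square_less_1)
  qed
  \<comment> \<open>The worst mode at time \<open>tmin\<close>. Inserting \<open>1 / 2\<close> keeps
    \<open>q\<close> positive and the maximum defined when there is no positive frequency.\<close>
  define q where "q = Max (insert (1 / 2) ((\<lambda>e. (jinc (\<omega> e * tmin))\<^sup>2) ` I))"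
  have q: "1 / 2 \<le> q" "q < 1" "\<And>e. e \<in> I \<Longrightarrow> (jinc (\<omega> e * tmin))\<^sup>2 \<le> q"
  proof -
    show "1 / 2 \<le> q"
      unfolding q_def using \<open>finite I\<close> by (intro Max_ge) auto
    show "q < 1"
      unfolding q_def using \<open>finite I\<close> sq_less by (subst Max_less_iff) auto
    show "(jinc (\<omega> e * tmin))\<^sup>2 \<le> q" if "e \<in> I" for e
      unfolding q_def using \<open>finite I\<close> that by (intro Max_ge) auto
  qed
  obtain T0 where "T0 > 0"
    and T0: "\<And>w. (\<And>i. i \<in> I \<Longrightarrow> w i \<ge> 0) \<Longrightarrow> (\<exists>i\<in>I. w i > 0) \<Longrightarrow>
      \<exists>t\<in>{0<..<T0}. (\<Sum>i\<in>I. w i * (\<omega> i * jinc (\<omega> i * t) * jinc_deriv (\<omega> i * t))) \<ge> 0"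
    using jinc_energy_not_decreasing[OF \<open>finite I\<close>, of \<omega>] by (auto simp: I_def)
  define tmax where "tmax = max tmin T0"
  have rate_I: "rate r t = (\<Sum>e\<in>I. ((\<omega> e)\<^sup>2 * ((r - p) \<bullet> e)\<^sup>2) *
      (\<omega> e * jinc (\<omega> e * t) * jinc_deriv (\<omega> e * t)))" for r t
    unfolding rate_def I_def using \<omega>_nonneg
    by (intro sum.mono_neutral_right finite_B) force+
  show ?thesis
  proof (rule that[of tmin tmax q])
    show "0 < tmin" "tmin \<le> tmax" "0 < q" "q < 1"
      using \<open>tmin > 0\<close> q by (auto simp: tmax_def)
    fix r
    let ?w = "\<lambda>e. (\<omega> e)\<^sup>2 * ((r - p) \<bullet> e)\<^sup>2"
    let ?S = "{t. t > 0 \<and> (\<forall>u\<in>{0<..<t}. rate r u < 0)}"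
    show "\<exists>T. 0 \<le> T \<and> T \<le> tmax \<and> (\<not> minimizer f r \<longrightarrow> tmin \<le> T) \<and>
      gr_restart_time f r = ennreal T \<and> (\<forall>t\<in>{0..T}. gap (flow r t) \<le> gap r) \<and>
      gap (flow r T) \<le> q * gap r"
    proof (cases "minimizer f r")
      case True
      then have "gap r = 0" by (simp add: minimizer_iff)
      then have "\<forall>e\<in>B. ?w e = 0"
        unfolding gap_def using finite_B by (simp add: sum_nonneg_eq_0_iff)
      then have "rate r t = 0" for t
        unfolding rate_def by (intro sum.neutral) simp
      \<comment> \<open>At a minimizer the rate is identically 0, so no time qualifies and the
        supremum of the empty set gives restart time 0.\<close>
      then have "?S = {}"
        using dense by auto
      then have "gr_restart_time f r = 0"
        unfolding gr_restart_time_eq by (simp only: image_empty) (simp add: bot_ennreal)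
      then show ?thesis
        using True \<open>gap r = 0\<close> \<open>tmin > 0\<close> by (intro exI[of _ 0]) (auto simp: tmax_def)
    next
      case False
      then have "(\<Sum>e\<in>B. ?w e) \<noteq> 0"
        unfolding minimizer_iff gap_def by simp
      then obtain e0 where "e0 \<in> B" "?w e0 \<noteq> 0"
        by (meson sum.neutral)
      then have "e0 \<in> I" "?w e0 > 0"
        using \<omega>_nonneg[of e0] by (auto simp: I_def less_le)
      have S_le: "t \<le> tmax" if "t \<in> ?S" for t
      proof (rule ccontr)
        assume "\<not> t \<le> tmax"
        obtain u where "u \<in> {0<..<T0}" "rate r u \<ge> 0"
          using T0[of ?w] \<open>e0 \<in> I\<close> \<open>?w e0 > 0\<close> unfolding rate_I by force
        then show False
          using that \<open>\<not> t \<le> tmax\<close> by (force simp: tmax_def)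
      qed
      have tmin_S: "tmin \<in> ?S"
      proof (intro CollectI conjI ballI \<open>tmin > 0\<close>)
        fix u assume u: "u \<in> {0<..<tmin}"
        have "- rate r u > 0"
          unfolding rate_I sum_negf[symmetric]
        proof (rule sum_pos2[OF \<open>finite I\<close> \<open>e0 \<in> I\<close>])
          have neg: "\<omega> e * jinc (\<omega> e * u) * jinc_deriv (\<omega> e * u) < 0" if "e \<in> I" for e
            using that u scaled_le[of e u] d_pos[of "\<omega> e * u"] d_neg[of "\<omega> e * u"]
            by (intro mult_pos_neg mult_pos_pos) (auto simp: I_def)
          show "0 < - (?w e0 * (\<omega> e0 * jinc (\<omega> e0 * u) * jinc_deriv (\<omega> e0 * u)))"
            using mult_pos_neg[OF \<open>?w e0 > 0\<close> neg[OF \<open>e0 \<in> I\<close>]] by simp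
          show "0 \<le> - (?w e * (\<omega> e * jinc (\<omega> e * u) * jinc_deriv (\<omega> e * u)))" if "e \<in> I" for e
            using mult_nonneg_nonpos[OF _ less_imp_le[OF neg[OF that]], of "?w e"] by simp
        qed
        then show "rate r u < 0" by simp
      qed
      have bdd: "bdd_above ?S"
        using S_le by (rule bdd_aboveI)
      define T where "T = Sup ?S"
      have "tmin \<le> T"
        unfolding T_def by (rule cSup_upper[OF tmin_S bdd])
      have "T \<le> tmax"
        unfolding T_def using tmin_S S_le by (intro cSup_least) auto
      have time: "gr_restart_time f r = ennreal T"
        unfolding gr_restart_time_eq T_def using tmin_S bdd by (intro Sup_ennreal_image) auto
      have rate_neg: "rate r u < 0" if "0 < u" "u < T" for u
      proof -
        have "\<exists>t\<in>?S. u < t"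
          using that(2) less_cSup_iff[OF _ bdd, of u] tmin_S unfolding T_def by blast
        then obtain t where "t \<in> ?S" "u < t"
          by blast
        then show ?thesis using that by auto
      qed
      have mono: "gap (flow r t) \<le> gap (flow r s)" if "0 \<le> s" "s \<le> t" "t \<le> T" for s t
      proof (rule DERIV_nonpos_imp_decreasing_open[OF \<open>s \<le> t\<close>, of "\<lambda>t. gap (flow r t)"])
        show "\<exists>y. ((\<lambda>t. gap (flow r t)) has_real_derivative y) (at x) \<and> y \<le> 0"
          if "s < x" "x < t" for x
          using DERIV_gap_flow rate_neg[of x] that \<open>0 \<le> s\<close> \<open>t \<le> T\<close>
          by (meson less_imp_le less_le_trans order.strict_trans1)
        show "continuous_on {s..t} (\<lambda>t. gap (flow r t))"
          by (rule DERIV_continuous_on) (rule has_field_derivative_at_within[OF DERIV_gap_flow])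
      qed
      \<comment> \<open>The factor \<open>q\<close> is gained at \<open>tmin\<close>, where each
        mode is controlled. Afterwards single modes may grow, but their weighted sum does not before
        the restart.\<close>
      have "gap (flow r T) \<le> gap (flow r tmin)"
        using \<open>tmin > 0\<close> \<open>tmin \<le> T\<close> by (intro mono) auto
      also have "\<dots> \<le> q * gap r"
      proof -
        have "?w e * (jinc (\<omega> e * tmin))\<^sup>2 \<le> q * ?w e" if "e \<in> B" for e
        proof (cases "e \<in> I")
          case True
          then show ?thesis
            using mult_left_mono[OF q(3)[OF True], of "?w e"] by (simp add: mult.commute)
        next
          case False
          then have "\<omega> e = 0" using that \<omega>_nonneg[OF that] by (auto simp: I_def)
          then show ?thesis by simp
        qed
        then have "(\<Sum>e\<in>B. ?w e * (jinc (\<omega> e * tmin))\<^sup>2) \<le> (\<Sum>e\<in>B. q * ?w e)"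
          by (rule sum_mono)
        also have "\<dots> = q * (\<Sum>e\<in>B. ?w e)"
          by (rule sum_distrib_left[symmetric])
        finally show ?thesis
          unfolding gap_flow gap_def[of r] by simp
      qed
      finally show ?thesis
        using \<open>tmin > 0\<close> \<open>tmin \<le> T\<close> \<open>T \<le> tmax\<close> time mono[of 0]
        by (intro exI[of _ T]) auto
    qed
  qed
qed

text \<open>At time \<open>t\<close> in segment \<open>i\<close> the gap has been contracted
  \<open>i\<close> times, while \<open>t\<close> is at most \<open>(i + 1) * tmax\<close>. The
  factor \<open>1 / q\<close> pays for the unfinished segment. Kernel coordinates are tracked as
  well because the gap does not see them and they determine the limit point.\<close>

lemma gr_trajectory_gap_decay:
  obtains c c2 where "0 < c" "0 < c2" "c2 < 1"
    and "\<And>x0 t. 0 \<le> t \<Longrightarrow> gap (gr_trajectory f x0 t) \<le> c * gap x0 * exp (- c2 * t)"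
    and "\<And>x0 t e. 0 \<le> t \<Longrightarrow> e \<in> B \<Longrightarrow> \<omega> e = 0 \<Longrightarrow>
      (gr_trajectory f x0 t - p) \<bullet> e = (x0 - p) \<bullet> e"
proof -
  obtain tmin tmax q where tq: "0 < tmin" "tmin \<le> tmax" "0 < q" "q < 1"
    and ex: "\<And>r. \<exists>T. 0 \<le> T \<and> T \<le> tmax \<and> (\<not> minimizer f r \<longrightarrow> tmin \<le> T) \<and>
      gr_restart_time f r = ennreal T \<and> (\<forall>t\<in>{0..T}. gap (flow r t) \<le> gap r) \<and>
      gap (flow r T) \<le> q * gap r"
    using restart_bounds by metis
  define T where "T r = enn2real (gr_restart_time f r)" for r
  have T: "0 \<le> T r" "T r \<le> tmax" "\<not> minimizer f r \<Longrightarrow> tmin \<le> T r"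
    "gr_restart_time f r = ennreal (T r)" "\<And>t. 0 \<le> t \<Longrightarrow> t \<le> T r \<Longrightarrow> gap (flow r t) \<le> gap r"
    "gap (flow r (T r)) \<le> q * gap r" for r
    using ex[of r] by (auto simp: T_def)
  have "tmax > 0" using tq by simp
  \<comment> \<open>\<open>- ln q / tmax\<close> is the exponential rate of losing a factor
    \<open>q\<close> per time \<open>tmax\<close>; the cap \<open>1 / 2\<close> keeps it below
    1.\<close>
  define c2 where "c2 = min (1 / 2) (- ln q / tmax)"
  have "ln q < 0" using tq by simp
  then have "0 < c2" "c2 < 1"
    using \<open>tmax > 0\<close> by (auto simp: c2_def divide_neg_pos)
  have decay: "q ^ i \<le> 1 / q * exp (- c2 * t)" if "0 \<le> t" "t \<le> (real i + 1) * tmax" for i t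
  proof -
    have "c2 * t \<le> (- ln q / tmax) * ((real i + 1) * tmax)"
      using that \<open>ln q < 0\<close> \<open>tmax > 0\<close> \<open>0 < c2\<close>
      by (intro mult_mono) (auto simp: c2_def divide_le_0_iff)
    also have "\<dots> = - (real (Suc i) * ln q)"
      using \<open>tmax > 0\<close> by simp
    finally have "real (Suc i) * ln q \<le> - (c2 * t)"
      by linarith
    then have "exp (real (Suc i) * ln q) \<le> exp (- (c2 * t))"
      by (simp only: exp_le_cancel_iff)
    moreover have "exp (real (Suc i) * ln q) = q ^ Suc i"
      using tq by (subst exp_of_nat_mult) simp
    ultimately have "q ^ Suc i \<le> exp (- (c2 * t))"
      by (simp only:)
    then show ?thesis
      using tq by (simp add: field_simps)
  qed
  have main: "gap (gr_trajectory f x0 t) \<le> 1 / q * gap x0 * exp (- c2 * t) \<and>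
      (\<forall>e\<in>B. \<omega> e = 0 \<longrightarrow> (gr_trajectory f x0 t - p) \<bullet> e = (x0 - p) \<bullet> e)" if "0 \<le> t" for x0 t
  proof -
    define r where "r i = gr_point f x0 i" for i
    \<comment> \<open>Real-valued restart instants. The sum runs below \<open>i\<close>, whereas
      \<open>gr_tau\<close> sums up to \<open>i\<close>, because \<open>gr_duration\<close> at index
      0 is 0 and shifts the restart times by one.\<close>
    define \<sigma> where "\<sigma> i = (\<Sum>j<i. T (r j))" for i
    have r_Suc: "r (Suc i) = flow (r i) (T (r i))" for i
      using T(1) by (simp add: r_def T_def ode_solution_eq_flow)
    have tau: "gr_tau f x0 i = ennreal (\<sigma> i)" for i
    proof (induction i)
      case 0
      show ?case by (simp add: gr_tau_def \<sigma>_def)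
    next
      case (Suc i)
      have "gr_tau f x0 (Suc i) = gr_tau f x0 i + ennreal (T (r i))"
        by (simp add: gr_tau_def T(4) r_def)
      also have "\<dots> = ennreal (\<sigma> i + T (r i))"
        unfolding Suc.IH using T(1) by (intro ennreal_plus[symmetric]) (auto simp: \<sigma>_def sum_nonneg)
      finally show ?case by (simp add: \<sigma>_def)
    qed
    have \<sigma>_nonneg: "0 \<le> \<sigma> i" for i
      unfolding \<sigma>_def using T(1) by (simp add: sum_nonneg)
    have \<sigma>_mono: "\<sigma> i \<le> \<sigma> j" if "i \<le> j" for i j
      unfolding \<sigma>_def using that T(1) by (intro sum_mono2) auto
    have gap_r: "gap (r i) \<le> q ^ i * gap x0" for i
    proof (induction i)
      case (Suc i)
      have "gap (r (Suc i)) \<le> q * gap (r i)"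
        unfolding r_Suc by (rule T(6))
      also have "\<dots> \<le> q * (q ^ i * gap x0)"
        using Suc tq by (intro mult_left_mono) auto
      finally show ?case by simp
    qed (simp add: r_def)
    have kernel_flow: "(flow y s - p) \<bullet> e = (y - p) \<bullet> e" if "e \<in> B" "\<omega> e = 0" for y s e
      using that by (simp add: flow_inner)
    have kernel_r: "(r i - p) \<bullet> e = (x0 - p) \<bullet> e" if "e \<in> B" "\<omega> e = 0" for i e
      using that by (induction i) (simp_all add: r_Suc kernel_flow, simp add: r_def)
    consider "t = 0"
      | "t > 0" "\<exists>i. minimizer f (gr_point f x0 i) \<and> gr_tau f x0 i \<le> ennreal t"
      | "t > 0" "\<nexists>i. minimizer f (gr_point f x0 i) \<and> gr_tau f x0 i \<le> ennreal t"
      using \<open>0 \<le> t\<close> by fastforce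
    then show ?thesis
    proof cases
      case 1
      then have "gr_trajectory f x0 t = x0"
        by (simp add: gr_trajectory_def)
      moreover have "gap x0 \<le> 1 / q * gap x0"
        using tq gap_nonneg[of x0] by (simp add: field_simps mult_left_le_one_le)
      ultimately show ?thesis
        using 1 by simp
    next
      case 2
      define m where
        "m = (LEAST i. minimizer f (gr_point f x0 i) \<and> gr_tau f x0 i \<le> ennreal t)"
      have "gr_trajectory f x0 t = r m"
        using 2 by (simp add: gr_trajectory_def m_def r_def)
      moreover have "minimizer f (r m)"
        unfolding r_def m_def using LeastI_ex[OF 2(2)] by blast
      ultimately show ?thesis
        using kernel_r gap_nonneg[of x0] tq by (simp add: minimizer_iff)
    next
      case 3
      have no_min: "\<not> minimizer f (r i)" if "\<sigma> i \<le> t" for i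
        using 3(2) ennreal_leI[OF that] unfolding tau r_def by blast
      \<comment> \<open>If all restart instants were below \<open>t\<close>, no restart point would
        be a minimizer, so every segment would last at least \<open>tmin\<close> and the instants
        would be unbounded.\<close>
      have "\<exists>n. t \<le> \<sigma> n"
      proof (rule ccontr)
        assume "\<nexists>n. t \<le> \<sigma> n"
        then have less: "\<sigma> n < t" for n by (simp add: not_le)
        have "real n * tmin \<le> \<sigma> n" for n
        proof -
          have "(\<Sum>j<n. tmin) \<le> \<sigma> n"
            unfolding \<sigma>_def using T(3)[OF no_min[OF less_imp_le[OF less]]] by (intro sum_mono) auto
          then show ?thesis by simp
        qed
        moreover obtain n where "t < real n * tmin"
          using reals_Archimedean3[OF \<open>0 < tmin\<close>] by blast
        ultimately show False
          using less[of n] by (meson not_le order_less_le_trans less_asym)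
      qed
      \<comment> \<open>The least such index is the right end of the half-open segment containing
        \<open>t\<close>; it is positive since \<open>\<sigma> 0 = 0\<close> and
        \<open>t > 0\<close>.\<close>
      define N where "N = (LEAST n. t \<le> \<sigma> n)"
      have N: "t \<le> \<sigma> N"
        unfolding N_def by (rule LeastI_ex) fact
      moreover have "\<sigma> 0 = 0" by (simp add: \<sigma>_def)
      ultimately have "N \<noteq> 0"
        using 3(1) by (cases N) auto
      then obtain i where i: "N = Suc i"
        using not0_implies_Suc by blast
      then have "\<sigma> i < t"
        using not_less_Least[of i "\<lambda>n. t \<le> \<sigma> n"] by (simp add: N_def not_le)
      have index: "(THE i. gr_tau f x0 i < ennreal t \<and> ennreal t \<le> gr_tau f x0 (Suc i)) = i"
      proof (rule the_equality)
        show "gr_tau f x0 i < ennreal t \<and> ennreal t \<le> gr_tau f x0 (Suc i)"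
          unfolding tau using \<open>\<sigma> i < t\<close> N i \<sigma>_nonneg by (simp add: ennreal_less_iff ennreal_leI)
        fix j assume "gr_tau f x0 j < ennreal t \<and> ennreal t \<le> gr_tau f x0 (Suc j)"
        then have j: "\<sigma> j < t" "t \<le> \<sigma> (Suc j)"
          unfolding tau using \<sigma>_nonneg by (simp_all add: ennreal_less_iff)
        have "\<not> Suc j \<le> i"
          using \<sigma>_mono[of "Suc j" i] j \<open>\<sigma> i < t\<close> by linarith
        moreover have "\<not> Suc i \<le> j"
          using \<sigma>_mono[of "Suc i" j] j N[unfolded i] by linarith
        ultimately show "j = i" by simp
      qed
      have s: "0 \<le> t - \<sigma> i" "t - \<sigma> i \<le> T (r i)"
        using \<open>\<sigma> i < t\<close> N i by (auto simp: \<sigma>_def)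
      have traj: "gr_trajectory f x0 t = flow (r i) (t - \<sigma> i)"
      proof -
        have "gr_trajectory f x0 t = ode_solution f (r i) (t - enn2real (gr_tau f x0 i))"
          unfolding gr_trajectory_def if_not_P[OF 3(2)] index Let_def r_def using 3(1) by simp
        then show ?thesis
          using \<sigma>_nonneg[of i] s by (simp add: tau ode_solution_eq_flow)
      qed
      have "\<sigma> (Suc i) \<le> (\<Sum>j<Suc i. tmax)"
        unfolding \<sigma>_def by (intro sum_mono T(2))
      then have "t \<le> (real i + 1) * tmax"
        using N i by (simp add: algebra_simps)
      have "gap (gr_trajectory f x0 t) \<le> gap (r i)"
        unfolding traj by (rule T(5)[OF s])
      also have "\<dots> \<le> q ^ i * gap x0"
        by (rule gap_r)
      also have "\<dots> \<le> 1 / q * exp (- c2 * t) * gap x0"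
        by (intro mult_right_mono decay gap_nonneg \<open>0 \<le> t\<close>) fact
      finally show ?thesis
        using kernel_flow kernel_r by (simp add: traj mult_ac)
    qed
  qed
  show ?thesis
    by (rule that[of "1 / q" c2]) (use tq \<open>0 < c2\<close> \<open>c2 < 1\<close> main in auto)
qed

text \<open>On points with the same kernel coordinates as \<open>x0\<close>, the gap lies between
  \<open>\<mu> / 2\<close> and \<open>L / 2\<close> times the squared distance to \<open>xs\<close>.
  The upper estimate is used at time 0 and the lower one at time \<open>t\<close>, which produces
  the constant \<open>c * L / \<mu>\<close>.\<close>

lemma gr_trajectory_linear_rate:
  assumes "L > 0" and lip: "L-lipschitz_on UNIV (gradient f)"
  shows "\<exists>c1>0. \<exists>c2\<in>{0<..<1}. \<exists>C>0. \<forall>x0. \<exists>xs. minimizer f xs \<and>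
           (\<forall>t\<ge>0. f (gr_trajectory f x0 t) - (INF x. f x)
                     \<le> c1 * L * (norm (x0 - xs))\<^sup>2 / 2 * exp (- c2 * t) \<and>
                   (norm (gr_trajectory f x0 t - xs))\<^sup>2
                     \<le> C * (norm (x0 - xs))\<^sup>2 * exp (- c2 * t))"
proof -
  obtain c c2 where c: "0 < c" "0 < c2" "c2 < 1"
    and gap_le: "\<And>x0 t. 0 \<le> t \<Longrightarrow> gap (gr_trajectory f x0 t) \<le> c * gap x0 * exp (- c2 * t)"
    and kernel: "\<And>x0 t e. 0 \<le> t \<Longrightarrow> e \<in> B \<Longrightarrow> \<omega> e = 0 \<Longrightarrow>
      (gr_trajectory f x0 t - p) \<bullet> e = (x0 - p) \<bullet> e"
    using gr_trajectory_gap_decay by metis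
  \<comment> \<open>The least nonzero eigenvalue, capped at 1 so that the minimum exists even if all
    eigenvalues vanish.\<close>
  define \<mu> where "\<mu> = Min (insert 1 ((\<lambda>e. (\<omega> e)\<^sup>2) ` {e \<in> B. \<omega> e \<noteq> 0}))"
  have "\<mu> > 0"
    unfolding \<mu>_def using finite_B by (subst Min_gr_iff) auto
  have \<mu>_le: "\<mu> \<le> (\<omega> e)\<^sup>2" if "e \<in> B" "\<omega> e \<noteq> 0" for e
    unfolding \<mu>_def using finite_B that by (intro Min_le) auto
  \<comment> \<open>Any Lipschitz constant of the gradient dominates the spectrum: compare the
    gradients at \<open>e\<close> and at 0.\<close>
  have \<omega>_le: "(\<omega> e)\<^sup>2 \<le> L" if "e \<in> B" for e
  proof -
    have "dist (gradient f e) (gradient f 0) \<le> L * dist e 0"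
      using lip by (rule lipschitz_onD) auto
    moreover have "gradient f e - gradient f 0 = (\<omega> e)\<^sup>2 *\<^sub>R e"
      using A_eigen[OF that] linear_0[OF A_linear] by (simp add: gradient_f A_diff linear_neg[OF A_linear])
    moreover have "norm e = 1"
      using orthonormal[OF that that] by (simp add: norm_eq_1)
    ultimately show ?thesis
      by (simp add: dist_norm)
  qed
  have "\<exists>xs. minimizer f xs \<and> (\<forall>t\<ge>0. f (gr_trajectory f x0 t) - (INF x. f x)
        \<le> c * L * (norm (x0 - xs))\<^sup>2 / 2 * exp (- c2 * t) \<and>
      (norm (gr_trajectory f x0 t - xs))\<^sup>2
        \<le> (c * L / \<mu>) * (norm (x0 - xs))\<^sup>2 * exp (- c2 * t))" for x0
  proof -
    \<comment> \<open>The orthogonal projection of \<open>x0\<close> onto the set of minimizers: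
      kernel coordinates from \<open>x0\<close>, all others from \<open>p\<close>. It does not
      depend on \<open>t\<close> because the trajectory preserves the kernel coordinates.\<close>
    define xs where "xs = p + (\<Sum>e\<in>B. (if \<omega> e = 0 then (x0 - p) \<bullet> e else 0) *\<^sub>R e)"
    have xs: "(xs - p) \<bullet> e = (if \<omega> e = 0 then (x0 - p) \<bullet> e else 0)" if "e \<in> B" for e
      unfolding xs_def using inner_basis_sum[OF that] by simp
    have "gap xs = 0"
      unfolding gap_def using xs by (simp add: sum.neutral)
    have sq: "(norm (x - xs))\<^sup>2 = (\<Sum>e\<in>B. if \<omega> e = 0 then 0 else ((x - p) \<bullet> e)\<^sup>2)"
      if "\<And>e. e \<in> B \<Longrightarrow> \<omega> e = 0 \<Longrightarrow> (x - p) \<bullet> e = (x0 - p) \<bullet> e" for x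
    proof -
      have "(norm (x - xs))\<^sup>2 = (\<Sum>e\<in>B. ((x - xs) \<bullet> e) * ((x - xs) \<bullet> e))"
        by (simp only: power2_norm_eq_inner inner_eq_basis_sum[of "x - xs" "x - xs"])
      moreover have "(x - xs) \<bullet> e = (if \<omega> e = 0 then 0 else (x - p) \<bullet> e)" if "e \<in> B" for e
      proof -
        have "(x - xs) \<bullet> e = (x - p) \<bullet> e - (xs - p) \<bullet> e"
          by (simp add: inner_diff_left)
        then show ?thesis
          using xs[OF that] \<open>\<And>e. e \<in> B \<Longrightarrow> \<omega> e = 0 \<Longrightarrow> (x - p) \<bullet> e = (x0 - p) \<bullet> e\<close>[OF that] by simp
      qed
      ultimately show ?thesis
        by (simp add: power2_eq_square if_distrib cong: sum.cong if_cong)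
    qed
    have gap_upper: "gap x0 \<le> L * (norm (x0 - xs))\<^sup>2 / 2"
    proof -
      have "(\<Sum>e\<in>B. (\<omega> e)\<^sup>2 * ((x0 - p) \<bullet> e)\<^sup>2) \<le>
          (\<Sum>e\<in>B. L * (if \<omega> e = 0 then 0 else ((x0 - p) \<bullet> e)\<^sup>2))"
        by (intro sum_mono) (auto intro: mult_right_mono \<omega>_le)
      also have "\<dots> = L * (norm (x0 - xs))\<^sup>2"
        by (subst sq) (simp_all only: sum_distrib_left)
      finally show ?thesis
        unfolding gap_def by simp
    qed
    have gap_lower: "\<mu> * (norm (x - xs))\<^sup>2 \<le> 2 * gap x"
      if "\<And>e. e \<in> B \<Longrightarrow> \<omega> e = 0 \<Longrightarrow> (x - p) \<bullet> e = (x0 - p) \<bullet> e" for x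
    proof -
      have "(\<Sum>e\<in>B. \<mu> * (if \<omega> e = 0 then 0 else ((x - p) \<bullet> e)\<^sup>2)) \<le>
          (\<Sum>e\<in>B. (\<omega> e)\<^sup>2 * ((x - p) \<bullet> e)\<^sup>2)"
        by (intro sum_mono) (auto intro: mult_right_mono \<mu>_le)
      then show ?thesis
        unfolding gap_def sum_distrib_left[symmetric] by (subst sq) (simp_all add: that)
    qed
    have "f (gr_trajectory f x0 t) - (INF x. f x)
        \<le> c * L * (norm (x0 - xs))\<^sup>2 / 2 * exp (- c2 * t) \<and>
      (norm (gr_trajectory f x0 t - xs))\<^sup>2
        \<le> (c * L / \<mu>) * (norm (x0 - xs))\<^sup>2 * exp (- c2 * t)" if "t \<ge> 0" for t
    proof -
      let ?x = "gr_trajectory f x0 t"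
      have "gap ?x \<le> c * gap x0 * exp (- c2 * t)"
        by (rule gap_le[OF that])
      also have "\<dots> \<le> c * (L * (norm (x0 - xs))\<^sup>2 / 2) * exp (- c2 * t)"
        using c by (intro mult_right_mono mult_left_mono gap_upper) auto
      finally have le: "gap ?x \<le> c * L * (norm (x0 - xs))\<^sup>2 / 2 * exp (- c2 * t)"
        by (simp add: mult_ac)
      have "\<mu> * (norm (?x - xs))\<^sup>2 \<le> 2 * gap ?x"
        by (rule gap_lower) (rule kernel[OF that])
      also have "\<dots> \<le> c * L * (norm (x0 - xs))\<^sup>2 * exp (- c2 * t)"
        using le by simp
      finally have "(norm (?x - xs))\<^sup>2 \<le> (c * L / \<mu>) * (norm (x0 - xs))\<^sup>2 * exp (- c2 * t)"
        using \<open>\<mu> > 0\<close> by (simp add: pos_le_divide_eq mult.commute)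
      then show ?thesis
        using le f_eq_gap[of ?x] by (simp add: Inf_f)
    qed
    then show ?thesis
      using \<open>gap xs = 0\<close> minimizer_iff by blast
  qed
  moreover have "c * L / \<mu> > 0"
    using c \<open>L > 0\<close> \<open>\<mu> > 0\<close> by simp
  ultimately show ?thesis
    using c by (metis greaterThanLessThan_iff)
qed

end

theorem theorem3:
  fixes A :: "real ^ 'n ^ 'n" and b :: "real ^ 'n"
    and f :: "real ^ 'n \<Rightarrow> real" and L :: real
  assumes "transpose A = A"
    and "\<And>x. 0 \<le> x \<bullet> (A *v x)"
    and "b \<in> range (\<lambda>x. A *v x)"
    and "f = (\<lambda>x. 1 / 2 * (x \<bullet> (A *v x)) + b \<bullet> x)"
    and "L > 0"
    and "L-lipschitz_on UNIV (gradient f)"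
  shows "\<exists>c1>0. \<exists>c2\<in>{0<..<1}. \<exists>C>0. \<forall>x0. \<exists>xs. minimizer f xs \<and>
           (\<forall>t\<ge>0. f (gr_trajectory f x0 t) - (INF x. f x)
                     \<le> c1 * L * (norm (x0 - xs))\<^sup>2 / 2 * exp (- c2 * t) \<and>
                   (norm (gr_trajectory f x0 t - xs))\<^sup>2
                     \<le> C * (norm (x0 - xs))\<^sup>2 * exp (- c2 * t))"
proof -
  have lin: "linear (\<lambda>x. A *v x)"
    by (rule matrix_vector_mul_linear)
  have sym: "(A *v x) \<bullet> y = x \<bullet> (A *v y)" for x y
    using assms(1) by (metis dot_lmul_matrix transpose_matrix_vector)
  obtain p where "b = A *v p"
    using assms(3) by blast
  \<comment> \<open>The gradient at \<open>x\<close> is \<open>A x + b\<close>, so the preimage of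
    \<open>b\<close> enters with a minus sign as the minimizer.\<close>
  then have p: "A *v (- p) = - b"
    using linear_neg[OF lin, of p] by simp
  show ?thesis
  proof (rule psd_eigenbasis[OF lin sym assms(2)])
    fix B \<omega>
    assume B: "finite B" "\<And>e e'. e \<in> B \<Longrightarrow> e' \<in> B \<Longrightarrow> e \<bullet> e' = (if e = e' then 1 else 0)"
      "\<And>x. x = (\<Sum>e\<in>B. (x \<bullet> e) *\<^sub>R e)" "\<And>e. e \<in> B \<Longrightarrow> A *v e = (\<omega> e)\<^sup>2 *\<^sub>R e"
      "\<And>e. e \<in> B \<Longrightarrow> 0 \<le> \<omega> e"
    interpret quadratic "\<lambda>x. A *v x" b f "- p" B \<omega>
      by (rule quadratic.intro) (fact lin sym assms(4) p B)+
    show ?thesis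
      by (rule gr_trajectory_linear_rate[OF assms(5,6)])
  qed
qed

end
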